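(* Let $n\ge 5$ be odd and $m=\frac{2^n+1}{3}$. Let $\ell\ge 1$ be such that $\rho_{\ell+1}=(0,0,k)$, i.e. $\rho_{\ell+1}=8k$, for some integer $k<m$. Then $$d_{ORD}(C_\ell(P_\infty))=\begin{cases} 2, & \text{if } k\le\lfloor\frac{3m}{8}\rfloor,\\ 3, & \text{if } \lceil\frac{3m}{8}\rceil\le k\le\lfloor\frac{m}{2}\rfloor,\\ 4, & \text{if } \lceil\frac{m}{2}\rceil\le k\le\lfloor\frac{5m}{8}\rfloor,\\ 5, & \text{if } \lceil\frac{5m}{8}\rceil\le k\le\lfloor\frac{3m}{4}\rfloor,\\ 6, & \text{if } \lceil\frac{3m}{4}\rceil\le k\le\lfloor\frac{7m}{8}\rfloor,\\ 8, & \text{if } \lceil\frac{7m}{8}\rceil\le k\le m-1.\end{cases}$$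
   Context: Let $n\ge5$ be odd, $m=(2^n+1)/3$, and let $GGS(2,n)$ be (the nonsingular model of) the curve $X^2+X=Y^{3}$, $Y^{4}-Y=Z^m$; it is $\mathbb F_{2^{2n}}$-maximal of genus $g=\frac{9m-7}{2}$ and has a unique point at infinity $P_\infty$. The Weierstrass semigroup $H(P_\infty)$ (the set of $r\ge 0$ such that some rational function has pole divisor $rP_\infty$) is known to be $$H(P_\infty)=\{3im+2jm+8k \mid i\in\{0,1\},\ j\in\{0,1,2,3\},\ k\ge0\},$$ and each element has a unique such representation; $(i,j,k)$ denotes the element $3im+2jm+8k$. Write $H(P_\infty)=\{\rho_1=0<\rho_2<\rho_3<\cdots\}$ (so $\ell\ge1$ forces $\rho_{\ell+1}>0$). For $\ell\ge1$, $\nu_\ell$ is the number of ordered pairs $(a,b)\in H(P_\infty)\times H(P_\infty)$ with $a+b=\rho_{\ell+1}$. Let $\overline D$ be the sum of all $\mathbb F_{2^{2n}}$-rational points other than $P_\infty$, and $C_\ell(P_\infty)=C^\perp(\overline D,\rho_\ell P_\infty)$ the dual of the one-point AG code obtained by evaluating $\mathcal L(\rho_\ell P_\infty)$ at the points of $\overline D$. The order bound (Feng-Rao designed minimum distance) is $d_{ORD}(C_\ell(P_\infty))=\min\{\nu_r\mid r\ge\ell\}$. *)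

theory Defs
  imports Complex_Main "HOL-Library.Infinite_Set" "HOL-Computational_Algebra.Polynomial"
begin

text \<open>
  The curve is treated through its function field over the field with \<open>2 ^ (2 * n)\<close> elements.
  The function field is the whole type, the constant field \<open>K\<close> is a subset of it, and the points
  of the nonsingular model (more precisely, its closed points) are the places, that is, the
  normalized discrete valuations that are trivial on \<open>K\<close>.
\<close>

definition is_subfield :: "'f::field set \<Rightarrow> bool" where
  "is_subfield K \<longleftrightarrow> 0 \<in> K \<and> 1 \<in> K \<and>
     (\<forall>a\<in>K. \<forall>b\<in>K. a - b \<in> K \<and> a * b \<in> K) \<and> (\<forall>a\<in>K. inverse a \<in> K)"

definition transcendental_over :: "'f::field set \<Rightarrow> 'f \<Rightarrow> bool" where
  "transcendental_over K t \<longleftrightarrow>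
     (\<forall>p. (\<forall>i. coeff p i \<in> K) \<and> poly p t = 0 \<longrightarrow> p = 0)"

text \<open>
  \<open>K(x, y, z)\<close> with \<open>z\<close> transcendental over \<open>K\<close> and the two equations of the curve. These
  conditions determine the extension up to isomorphism: since \<open>m\<close> is odd, the place \<open>z = \<infinity>\<close> of
  \<open>K(z)\<close> is totally ramified in \<open>K(y, z)\<close> and in \<open>K(x, y, z)\<close>, so both defining equations are
  irreducible and \<open>K(x, y, z)\<close> has degree 8 over \<open>K(z)\<close>.
\<close>

definition GGS_function_field :: "nat \<Rightarrow> 'f::field set \<Rightarrow> 'f \<Rightarrow> 'f \<Rightarrow> 'f \<Rightarrow> bool" where
  "GGS_function_field n K x y z \<longleftrightarrow>
     is_subfield K \<and> card K = 2 ^ (2 * n) \<and>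
     transcendental_over K z \<and>
     x ^ 2 + x = y ^ 3 \<and> y ^ 4 - y = z ^ ((2 ^ n + 1) div 3) \<and>
     (\<forall>L. is_subfield L \<and> K \<subseteq> L \<and> {x, y, z} \<subseteq> L \<longrightarrow> L = UNIV)"

text \<open>
  The value at \<open>0\<close> (conventionally \<open>\<infinity>\<close>) is set to the dummy value \<open>0\<close>, so that two places are
  equal exactly when they are equal as functions.
\<close>

definition is_place :: "'f::field set \<Rightarrow> ('f \<Rightarrow> int) \<Rightarrow> bool" where
  "is_place K v \<longleftrightarrow>
     v 0 = 0 \<and>
     (\<forall>f g. f \<noteq> 0 \<and> g \<noteq> 0 \<longrightarrow> v (f * g) = v f + v g) \<and>
     (\<forall>f g. f \<noteq> 0 \<and> g \<noteq> 0 \<and> f + g \<noteq> 0 \<longrightarrow> v (f + g) \<ge> min (v f) (v g)) \<and>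
     (\<forall>c\<in>K. v c = 0) \<and>
     (\<exists>t. t \<noteq> 0 \<and> v t = 1)"

definition is_place_at_infinity ::
    "'f::field set \<Rightarrow> 'f \<Rightarrow> 'f \<Rightarrow> 'f \<Rightarrow> ('f \<Rightarrow> int) \<Rightarrow> bool" where
  "is_place_at_infinity K x y z P \<longleftrightarrow> is_place K P \<and> (P x < 0 \<or> P y < 0 \<or> P z < 0)"

text \<open>
  The condition on \<open>f\<close> says that the pole divisor of \<open>f\<close>, whose coefficient at a place \<open>Q\<close> is
  \<open>max 0 (- Q f)\<close>, equals \<open>r P\<close>.
\<close>

definition weierstrass_semigroup :: "'f::field set \<Rightarrow> ('f \<Rightarrow> int) \<Rightarrow> nat set" where
  "weierstrass_semigroup K P =
     {r. \<exists>f. f \<noteq> 0 \<and> (\<forall>Q. is_place K Q \<longrightarrow> max 0 (- Q f) = (if Q = P then int r else 0))}"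

text \<open>
  The increasing enumeration of an infinite set of natural numbers, with indices starting at \<open>1\<close>.
\<close>

definition rho :: "nat set \<Rightarrow> nat \<Rightarrow> nat" where
  "rho H l = enumerate H (l - 1)"

definition nu :: "nat set \<Rightarrow> nat \<Rightarrow> nat" where
  "nu H l = card {(a, b). a \<in> H \<and> b \<in> H \<and> a + b = rho H (l + 1)}"

text \<open>
  The order bound \<open>d\<^sub>O\<^sub>R\<^sub>D(C\<^sub>l(P))\<close> of the dual one-point code \<open>C\<^sub>l(P)\<close> is defined from the
  semigroup \<open>H = H(P)\<close> and the index \<open>l\<close> alone. \<open>Inf\<close> of a nonempty set of natural numbers is
  its minimum.
\<close>

definition d_ORD :: "nat set \<Rightarrow> nat \<Rightarrow> nat" where
  "d_ORD H l = Inf {nu H r | r. r \<ge> l}"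

end

theory Submission
  imports Defs "HOL-Number_Theory.Cong"
begin

text \<open>
  With \<open>w = y\<^sup>2 + y\<close> the function field is a tower of three quadratic Artin-Schreier extensions
  \<open>w\<^sup>2 + w = z\<^sup>m\<close>, \<open>y\<^sup>2 + y = w\<close>, \<open>x\<^sup>2 + x = y\<^sup>3\<close> of \<open>K(z)\<close>. At a place at infinity the eight products
  of \<open>w\<close>, \<open>y\<close>, \<open>x\<close> have pole orders that are incongruent modulo 8, so the valuation of a
  \<open>K(z)\<close>-linear combination is the minimum over its terms. This makes the place unique and gives the
  pole orders of the elements of \<open>R = K[z, w, y, x]\<close>. Functions that are regular outside infinity lie in
  \<open>R\<close>: squaring sends the basis \<open>1, x\<close> of each step to a basis, so \<open>R / p R\<close> is reduced for each
  prime \<open>p\<close> of \<open>K[z]\<close>, and a function with \<open>p\<close> in its denominator has a pole at some place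
  above \<open>p\<close>, for which \<open>p\<close> is a uniformizer.

  For the order bound, an element \<open>3im + 2jm + 8k\<close> of the semigroup has at least
  \<open>(i + 1) (j + 1) (k + 1)\<close> decompositions, and the minimum is attained at \<open>3m\<close>, \<open>4m\<close>, \<open>5m\<close>, \<open>6m\<close>,
  \<open>7m\<close> and \<open>9m\<close> respectively.
\<close>

section \<open>Discrete valuations\<close>

locale place =
  fixes K :: "'f::field set" and v :: "'f \<Rightarrow> int"
  assumes place: "is_place K v"
begin

lemma v_zero [simp]: "v 0 = 0"
  using place by (simp add: is_place_def)

lemma v_mult: "f \<noteq> 0 \<Longrightarrow> g \<noteq> 0 \<Longrightarrow> v (f * g) = v f + v g"
  using place by (simp add: is_place_def)

lemma v_add: "f \<noteq> 0 \<Longrightarrow> g \<noteq> 0 \<Longrightarrow> f + g \<noteq> 0 \<Longrightarrow> min (v f) (v g) \<le> v (f + g)"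
  using place by (simp add: is_place_def)

lemma v_const: "c \<in> K \<Longrightarrow> v c = 0"
  using place by (simp add: is_place_def)

lemma v_one [simp]: "v 1 = 0"
  using v_mult[of 1 1] by simp

lemma v_minus [simp]: "v (- f) = v f"
proof -
  have "v (-1) = 0" using v_mult[of "-1" "-1"] by simp
  thus ?thesis using v_mult[of "-1" f] by (cases "f = 0") auto
qed

lemma v_power: "f \<noteq> 0 \<Longrightarrow> v (f ^ k) = int k * v f"
  by (induction k) (auto simp: v_mult algebra_simps)

text \<open>The ultrametric inequality for \<open>f = (f + g) - g\<close>, together with
  \<open>v f < v g\<close>, gives the missing bound on \<open>v (f + g)\<close>.\<close>

lemma v_add_eq:
  assumes "f \<noteq> 0" "g \<noteq> 0" "v f < v g"
  shows "f + g \<noteq> 0" "v (f + g) = v f"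
proof -
  show nz: "f + g \<noteq> 0"
    using assms v_minus[of g] by (auto simp: add_eq_0_iff2)
  have "min (v (f + g)) (v g) \<le> v f"
    using v_add[of "f + g" "- g"] nz assms by auto
  moreover have "v f \<le> v (f + g)" using v_add[of f g] nz assms by auto
  ultimately show "v (f + g) = v f" using assms by auto
qed

lemma v_add_min:
  assumes "f \<noteq> 0" "g \<noteq> 0" "v f \<noteq> v g"
  shows "f + g \<noteq> 0" "v (f + g) = min (v f) (v g)"
  using v_add_eq[of f g] v_add_eq[of g f] assms
  by (cases "v f < v g"; force simp: add.commute)+

text \<open>Both defining equations of the curve are of this shape, with \<open>d = 2\<close> and \<open>d = 4\<close>.\<close>

lemma v_artin_schreier:
  assumes "f \<noteq> 0" "f ^ d - f \<noteq> 0" "d \<ge> 2"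
  shows "v f < 0 \<Longrightarrow> v (f ^ d - f) = int d * v f"
    and "v f \<ge> 0 \<Longrightarrow> v (f ^ d - f) \<ge> 0"
proof -
  assume "v f < 0"
  hence "int d * v f \<le> 2 * v f" using assms(3) by (simp add: mult_right_mono_neg)
  hence "int d * v f < v f" using \<open>v f < 0\<close> by linarith
  thus "v (f ^ d - f) = int d * v f"
    using v_add_eq(2)[of "f ^ d" "- f"] assms by (simp add: v_power)
next
  assume "v f \<ge> 0"
  moreover have "min (v (f ^ d)) (v (- f)) \<le> v (f ^ d + - f)"
    using assms by (intro v_add) auto
  ultimately show "v (f ^ d - f) \<ge> 0" using assms(1)
    by (auto simp: v_power min_def split: if_splits intro: order_trans[rotated])
qed

end

section \<open>Quadratic Artin-Schreier extensions of subrings\<close>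

definition is_subring :: "'f::field set \<Rightarrow> bool" where
  "is_subring R \<longleftrightarrow> 0 \<in> R \<and> 1 \<in> R \<and> (\<forall>a\<in>R. \<forall>b\<in>R. a - b \<in> R \<and> a * b \<in> R)"

text \<open>This is the ring \<open>B[x]\<close> as soon as \<open>x\<close> is a root of a monic
  quadratic polynomial over \<open>B\<close>.\<close>

definition adjoin :: "'f::field set \<Rightarrow> 'f \<Rightarrow> 'f set" where
  "adjoin B x = {u + v * x | u v. u \<in> B \<and> v \<in> B}"

definition multiples :: "'f::field set \<Rightarrow> 'f \<Rightarrow> 'f set" where
  "multiples R p = {p * r | r. r \<in> R}"

text \<open>The quotient \<open>R / p R\<close> has no nonzero nilpotents. Squares suffice, since
  every exponent can be raised to a power of two.\<close>

definition reduced_mod :: "'f::field set \<Rightarrow> 'f \<Rightarrow> bool" where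
  "reduced_mod R p \<longleftrightarrow> (\<forall>r\<in>R. r ^ 2 \<in> multiples R p \<longrightarrow> r \<in> multiples R p)"

lemma is_subringD:
  assumes "is_subring R"
  shows "0 \<in> R" "1 \<in> R" "a \<in> R \<Longrightarrow> b \<in> R \<Longrightarrow> a - b \<in> R"
    "a \<in> R \<Longrightarrow> b \<in> R \<Longrightarrow> a * b \<in> R" "a \<in> R \<Longrightarrow> b \<in> R \<Longrightarrow> a + b \<in> R"
    "a \<in> R \<Longrightarrow> - a \<in> R" "a \<in> R \<Longrightarrow> a ^ k \<in> R"
proof -
  have neg: "- a \<in> R" if "a \<in> R" for a
    using assms that unfolding is_subring_def by (metis diff_0)
  show "0 \<in> R" "1 \<in> R" "a \<in> R \<Longrightarrow> b \<in> R \<Longrightarrow> a - b \<in> R" "a \<in> R \<Longrightarrow> b \<in> R \<Longrightarrow> a * b \<in> R"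
    using assms by (auto simp: is_subring_def)
  show "a \<in> R \<Longrightarrow> - a \<in> R" by (rule neg)
  show "a \<in> R \<Longrightarrow> b \<in> R \<Longrightarrow> a + b \<in> R"
    using assms neg unfolding is_subring_def by (metis diff_minus_eq_add)
  show "a \<in> R \<Longrightarrow> a ^ k \<in> R"
    using assms by (induction k) (auto simp: is_subring_def)
qed

lemma multiples_mult:
  "is_subring R \<Longrightarrow> a \<in> multiples R p \<Longrightarrow> r \<in> R \<Longrightarrow> r * a \<in> multiples R p"
  unfolding multiples_def using is_subringD(4) mult.left_commute by blast

lemma multiples_add:
  assumes "is_subring R" "a \<in> multiples R p" "b \<in> multiples R p"
  shows "a + b \<in> multiples R p"
proof -
  obtain r s where "r \<in> R" "a = p * r" "s \<in> R" "b = p * s" using assms by (auto simp: multiples_def)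
  hence "a + b = p * (r + s)" "r + s \<in> R" using is_subringD(5)[OF assms(1)] by (auto simp: algebra_simps)
  thus ?thesis by (auto simp: multiples_def)
qed

lemma adjoinI: "u \<in> B \<Longrightarrow> v \<in> B \<Longrightarrow> u + v * x \<in> adjoin B x"
  by (auto simp: adjoin_def)

lemma subset_adjoin: "is_subring B \<Longrightarrow> B \<subseteq> adjoin B x"
  using adjoinI[of _ B 0 x] is_subringD(1) by fastforce

lemma gen_in_adjoin: "is_subring B \<Longrightarrow> x \<in> adjoin B x"
  using adjoinI[of 0 B 1 x] is_subringD(1,2) by fastforce

lemma is_subring_adjoin:
  assumes B: "is_subring B" and x: "x ^ 2 = x + b" "b \<in> B"
  shows "is_subring (adjoin B x)"
proof -
  note s = is_subringD[OF B]
  have "f - g \<in> adjoin B x \<and> f * g \<in> adjoin B x"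
    if fg: "f \<in> adjoin B x" "g \<in> adjoin B x" for f g
  proof -
    obtain u v u' v' where f: "f = u + v * x" "u \<in> B" "v \<in> B" and g: "g = u' + v' * x" "u' \<in> B" "v' \<in> B"
      using fg by (auto simp: adjoin_def)
    have "f - g = (u - u') + (v - v') * x" by (simp add: f g algebra_simps)
    moreover have "f * g = u * u' + (u * v' + v * u') * x + v * v' * x ^ 2"
      by (simp add: f g algebra_simps power2_eq_square)
    hence "f * g = (u * u' + v * v' * b) + (u * v' + v * u' + v * v') * x"
      by (simp add: x(1) algebra_simps)
    moreover have "u - u' \<in> B" "v - v' \<in> B" "u * u' + v * v' * b \<in> B" "u * v' + v * u' + v * v' \<in> B"
      using f g x(2) by (auto intro!: s)
    ultimately show ?thesis by (metis adjoinI)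
  qed
  moreover have "0 \<in> adjoin B x" "1 \<in> adjoin B x" using subset_adjoin[OF B] s by auto
  ultimately show ?thesis by (simp add: is_subring_def)
qed

text \<open>The conjugate of \<open>u + v x\<close> is \<open>u + v (x + 1)\<close>. If it vanishes, \<open>u + v x\<close> already lies
  in \<open>B\<close>.\<close>

lemma adjoin_norm:
  assumes B: "is_subring B" and x: "x ^ 2 = x + b" "b \<in> B" and two: "(2::'f::field) = 0"
    and r: "r \<in> adjoin B (x::'f)" "r \<noteq> 0"
  shows "\<exists>r'\<in>adjoin B x. r * r' \<in> B \<and> r * r' \<noteq> 0"
proof -
  note s = is_subringD[OF B]
  obtain u v where uv: "r = u + v * x" "u \<in> B" "v \<in> B" using r by (auto simp: adjoin_def)
  define r' where "r' = (u + v) + v * x"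
  have r': "r' \<in> adjoin B x" unfolding r'_def using uv by (intro adjoinI s)
  show ?thesis
  proof (cases "r' = 0")
    case True
    hence "r + v = 0" by (simp add: r'_def uv algebra_simps)
    moreover have "v + v = 0" using two by (metis mult_2 mult_zero_left)
    ultimately have "r \<in> B" using uv(3) by (metis add_right_cancel)
    thus ?thesis using r(2) subset_adjoin[OF B] s by (intro bexI[of _ 1]) auto
  next
    case False
    have "r * r' = u ^ 2 + u * v + u * v * x + u * v * x + v ^ 2 * x + v ^ 2 * x ^ 2"
      by (simp add: uv(1) r'_def algebra_simps power2_eq_square)
    also have "\<dots> = u ^ 2 + u * v + v ^ 2 * b + 2 * (u * v * x + v ^ 2 * x)"
      unfolding x(1) by (simp add: algebra_simps)
    finally have "r * r' = u ^ 2 + u * v + v ^ 2 * b" using two by simp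
    hence "r * r' \<in> B" using uv x(2) by (auto intro!: s)
    thus ?thesis using False r r' by auto
  qed
qed

text \<open>In characteristic 2 the square of \<open>u + v x\<close> is \<open>(u\<^sup>2 + v\<^sup>2 b) + v\<^sup>2 x\<close>: the extension is
  unramified.\<close>

lemma reduced_mod_adjoin:
  assumes B: "is_subring B" and x: "x ^ 2 = x + b" "b \<in> B" and two: "(2::'f::field) = 0"
    and indep: "\<And>u v. u \<in> B \<Longrightarrow> v \<in> B \<Longrightarrow> u + v * (x::'f) = 0 \<Longrightarrow> u = 0 \<and> v = 0"
    and red: "reduced_mod B p" and p: "p \<in> B"
  shows "reduced_mod (adjoin B x) p"
  unfolding reduced_mod_def
proof (intro ballI impI)
  note s = is_subringD[OF B]
  fix r assume "r \<in> adjoin B x" and r2: "r ^ 2 \<in> multiples (adjoin B x) p"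
  then obtain u v where uv: "r = u + v * x" "u \<in> B" "v \<in> B" by (auto simp: adjoin_def)
  obtain c d where cd: "r ^ 2 = p * (c + d * x)" "c \<in> B" "d \<in> B"
    using r2 by (auto simp: multiples_def adjoin_def)
  have "r ^ 2 = u ^ 2 + v ^ 2 * x ^ 2 + 2 * (u * v * x)"
    by (simp add: uv(1) algebra_simps power2_eq_square)
  also have "\<dots> = u ^ 2 + v ^ 2 * b + v ^ 2 * x"
    unfolding x(1) using two by (simp add: algebra_simps)
  finally have "(u ^ 2 + v ^ 2 * b - p * c) + (v ^ 2 - p * d) * x = 0"
    using cd(1) by (simp add: algebra_simps)
  moreover have "u ^ 2 + v ^ 2 * b - p * c \<in> B" "v ^ 2 - p * d \<in> B"
    using uv cd x(2) p by (auto intro!: s)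
  ultimately have 0: "u ^ 2 + v ^ 2 * b - p * c = 0" "v ^ 2 - p * d = 0"
    using indep by blast+
  \<comment> \<open>The coefficient of \<open>x\<close> comes first: once \<open>p\<close> divides
    \<open>v\<close>, the term \<open>v ^ 2 * b\<close> of the other coefficient is divisible by
    \<open>p\<close>, which leaves \<open>u ^ 2\<close>.\<close>
  hence "v ^ 2 \<in> multiples B p" using cd by (auto simp: multiples_def)
  hence "v \<in> multiples B p" using red uv by (auto simp: reduced_mod_def)
  then obtain v' where v': "v = p * v'" "v' \<in> B" by (auto simp: multiples_def)
  have "u ^ 2 = p * (c - v * v' * b)"
    using 0(1) unfolding v'(1) by (simp add: algebra_simps power2_eq_square)
  moreover have "c - v * v' * b \<in> B" using cd uv v' x(2) by (auto intro!: s)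
  ultimately have "u ^ 2 \<in> multiples B p" by (auto simp: multiples_def)
  hence "u \<in> multiples B p" using red uv by (auto simp: reduced_mod_def)
  then obtain u' where u': "u = p * u'" "u' \<in> B" by (auto simp: multiples_def)
  have "r = p * (u' + v' * x)" by (simp add: uv(1) u' v' algebra_simps)
  thus "r \<in> multiples (adjoin B x) p"
    unfolding multiples_def using u' v' adjoinI by blast
qed

context place
begin

text \<open>Values on \<open>B\<close> are multiples of \<open>2 * d\<close> while
  \<open>v x\<close> is an odd multiple of \<open>d\<close>. So \<open>a\<close> and
  \<open>b * x\<close> never have equal values, and the ultrametric inequality is an equality. The
  default \<open>v 0 = 0\<close> keeps the divisibility statements valid at
  \<open>0\<close>.\<close>

lemma adjoin_valuation:
  assumes "\<forall>u\<in>B. 2 * d dvd v u" and "\<not> 2 * d dvd v x" and "d dvd v x" and "x \<noteq> 0"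
    and "a \<in> B" "b \<in> B"
  shows "a + b * x = 0 \<Longrightarrow> a = 0 \<and> b = 0"
    and "d dvd v (a + b * x)"
    and "a \<noteq> 0 \<Longrightarrow> b \<noteq> 0 \<Longrightarrow> v (a + b * x) = min (v a) (v b + v x)"
proof -
  have nz: "a + b * x \<noteq> 0 \<and> v (a + b * x) = min (v a) (v b + v x)" if "a \<noteq> 0" "b \<noteq> 0"
  proof -
    have "v a \<noteq> v b + v x"
    proof
      assume "v a = v b + v x"
      hence "v x = v a - v b" by simp
      thus False using assms by (metis dvd_diff)
    qed
    thus ?thesis
      using that assms(4) v_add_min[of a "b * x"] by (simp add: v_mult)
  qed
  show "a + b * x = 0 \<Longrightarrow> a = 0 \<and> b = 0" using nz assms(4) by (metis add_cancel_right_left mult_eq_0_iff mult_zero_left add.right_neutral)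
  show "a \<noteq> 0 \<Longrightarrow> b \<noteq> 0 \<Longrightarrow> v (a + b * x) = min (v a) (v b + v x)" using nz by blast
  have da: "d dvd v a" "d dvd v b" using assms by (meson dvd_mult_right dvd_trans dvd_triv_right)+
  show "d dvd v (a + b * x)"
    using nz da assms(3,4) by (cases "a = 0"; cases "b = 0") (auto simp: v_mult min_def)
qed

end

section \<open>Places above a prime of the base ring\<close>

text \<open>Intended for \<open>A = K[z]\<close> with a prime element \<open>p\<close> and a ring
  \<open>R\<close> that is finite over \<open>A\<close>. \<open>bezout\<close> makes
  \<open>A / p A\<close> a field, \<open>norm\<close> sends elements of \<open>R\<close> down to
  \<open>A\<close>, and \<open>fraction\<close> says that the whole field consists of elements of
  \<open>R\<close> over denominators from \<open>A\<close>.\<close>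

locale unramified_prime =
  fixes A R :: "'f::field set" and p :: 'f
  assumes A: "is_subring A" and R: "is_subring R" and A_R: "A \<subseteq> R"
    and p: "p \<in> A" "p \<noteq> 0"
    and reduced: "reduced_mod R p"
    and bezout: "\<And>a. a \<in> A \<Longrightarrow> a \<notin> multiples A p \<Longrightarrow> \<exists>u\<in>A. \<exists>w\<in>A. u * a + w * p = 1"
    and factor: "\<And>a. a \<in> A \<Longrightarrow> a \<noteq> 0 \<Longrightarrow> \<exists>k. \<exists>b\<in>A. a = p ^ k * b \<and> b \<notin> multiples A p"
    and norm: "\<And>r. r \<in> R \<Longrightarrow> r \<noteq> 0 \<Longrightarrow> \<exists>r'\<in>R. r * r' \<in> A \<and> r * r' \<noteq> 0"
    and fraction: "\<And>f. \<exists>a\<in>A. a \<noteq> 0 \<and> a * f \<in> R"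
begin

lemmas R_closed = is_subringD[OF R]

lemma p_R: "p \<in> R"
  using p A_R by auto

lemma multiplesI: "r \<in> R \<Longrightarrow> p * r \<in> multiples R p"
  by (auto simp: multiples_def)

text \<open>The exponent \<open>k\<close> is enlarged to \<open>2 ^ k\<close>, and then the square
  condition is applied \<open>k\<close> times.\<close>

lemma reduced_power:
  assumes "r \<in> R" "r ^ k \<in> multiples R p"
  shows "r \<in> multiples R p"
proof -
  have *: "r ^ (2 ^ j) \<in> multiples R p \<Longrightarrow> r \<in> multiples R p" for j
  proof (induction j)
    case (Suc j)
    have "(r ^ (2 ^ j)) ^ 2 \<in> multiples R p" using Suc.prems by (simp add: power_mult[symmetric] mult.commute)
    hence "r ^ (2 ^ j) \<in> multiples R p"
      using reduced assms(1) R_closed(7) by (auto simp: reduced_mod_def)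
    thus ?case by (rule Suc.IH)
  qed simp
  have "k \<le> 2 ^ k" by (simp add: less_imp_le)
  hence "r ^ (2 ^ k) = r ^ (2 ^ k - k) * r ^ k" by (simp add: power_add[symmetric])
  also have "\<dots> \<in> multiples R p" using assms R R_closed(7) by (intro multiples_mult)
  finally show ?thesis by (rule *)
qed

text \<open>A multiplicative set that is maximal among those avoiding \<open>p R\<close> is the complement of a minimal
  prime ideal over \<open>p R\<close>. As \<open>R / p R\<close> is reduced, this prime ideal is generated by \<open>p\<close>
  locally.\<close>

definition max_multiplicative :: "'f set \<Rightarrow> bool" where
  "max_multiplicative S \<longleftrightarrow> S \<subseteq> R \<and> 1 \<in> S \<and> (\<forall>s\<in>S. \<forall>t\<in>S. s * t \<in> S) \<and>
     S \<inter> multiples R p = {} \<and> (\<forall>r\<in>R - S. \<exists>s\<in>S. s * r \<in> multiples R p)"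

text \<open>Zorn's lemma, started at the powers of \<open>g\<close>; these avoid \<open>p R\<close>
  because \<open>R / p R\<close> is reduced. For \<open>r\<close> outside a maximal
  \<open>S\<close>, the set generated by \<open>S\<close> and \<open>r\<close> must meet
  \<open>p R\<close>.\<close>

lemma max_multiplicative_exists:
  assumes g: "g \<in> R" "g \<notin> multiples R p"
  shows "\<exists>S. max_multiplicative S \<and> g \<in> S"
proof -
  define F where "F = {S. S \<subseteq> R \<and> 1 \<in> S \<and> g \<in> S \<and> (\<forall>s\<in>S. \<forall>t\<in>S. s * t \<in> S) \<and> S \<inter> multiples R p = {}}"
  have "range (\<lambda>k. g ^ k) \<in> F"
  proof -
    have "1 = g ^ 0" "g = g ^ 1" by auto
    hence "1 \<in> range (\<lambda>k. g ^ k)" "g \<in> range (\<lambda>k. g ^ k)" by blast+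
    moreover have "range (\<lambda>k. g ^ k) \<inter> multiples R p = {}" using reduced_power g by auto
    moreover have "\<forall>s\<in>range (\<lambda>k. g ^ k). \<forall>t\<in>range (\<lambda>k. g ^ k). s * t \<in> range (\<lambda>k. g ^ k)"
      by (auto simp: power_add[symmetric])
    ultimately show ?thesis using g R_closed(7) by (auto simp: F_def)
  qed
  moreover have "\<Union>C \<in> F" if C: "C \<noteq> {}" "subset.chain F C" for C
  proof -
    have CF: "C \<subseteq> F" using C by (auto simp: subset.chain_def)
    have "s * t \<in> \<Union>C" if st: "s \<in> \<Union>C" "t \<in> \<Union>C" for s t
    proof -
      obtain S T where ST: "S \<in> C" "T \<in> C" "s \<in> S" "t \<in> T" using st by blast
      then have "S \<subseteq> T \<or> T \<subseteq> S" using C(2) by (auto simp: subset_chain_def)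
      then obtain U where "U \<in> C" "s \<in> U" "t \<in> U" using ST by blast
      thus ?thesis using CF by (auto simp: F_def)
    qed
    thus ?thesis using CF C(1) unfolding F_def by blast
  qed
  ultimately obtain S where S: "S \<in> F" and max: "\<And>T. T \<in> F \<Longrightarrow> S \<subseteq> T \<Longrightarrow> T = S"
    using subset_Zorn_nonempty[of F] by blast
  have "\<exists>s\<in>S. s * r \<in> multiples R p" if r: "r \<in> R" "r \<notin> S" for r
  proof -
    define T where "T = {s * r ^ k | s k. s \<in> S}"
    have ST: "S \<subseteq> T"
    proof
      fix s assume "s \<in> S"
      moreover have "s = s * r ^ 0" by simp
      ultimately show "s \<in> T" unfolding T_def by blast
    qed
    have "1 \<in> S" using S by (simp add: F_def)
    hence "1 * r ^ 1 \<in> T" unfolding T_def by blast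
    hence "T \<noteq> S" using r by auto
    hence "T \<notin> F" using max ST by blast
    moreover have "T \<subseteq> R" using S r R_closed by (auto simp: T_def F_def)
    moreover have "a * b \<in> T" if ab: "a \<in> T" "b \<in> T" for a b
    proof -
      obtain s i t j where "a = s * r ^ i" "b = t * r ^ j" "s \<in> S" "t \<in> S"
        using ab by (auto simp: T_def)
      moreover from this have "a * b = (s * t) * r ^ (i + j)" by (simp add: power_add mult_ac)
      moreover have "s * t \<in> S" using S calculation by (auto simp: F_def)
      ultimately show ?thesis unfolding T_def by blast
    qed
    ultimately have "T \<inter> multiples R p \<noteq> {}" using S ST unfolding F_def by blast
    then obtain s k where sk: "s \<in> S" "s * r ^ k \<in> multiples R p" by (auto simp: T_def)
    have sR: "s \<in> R" using sk S by (auto simp: F_def)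
    \<comment> \<open>Maximality yields only \<open>s * r ^ k\<close> in \<open>p R\<close>. Making
      it a multiple of a power of \<open>s * r\<close> lets reducedness remove the exponent.\<close>
    have "(s * r) ^ Suc k = (s ^ k * r) * (s * r ^ k)" by (simp add: power_mult_distrib mult_ac)
    also have "\<dots> \<in> multiples R p" using multiples_mult[OF R sk(2)] sR r R_closed(4,7) by blast
    finally have "s * r \<in> multiples R p" using reduced_power R_closed(4) sR r by blast
    thus ?thesis using sk by blast
  qed
  thus ?thesis using S by (auto simp: max_multiplicative_def F_def)
qed

end

section \<open>The valuation of the localization at a minimal prime over \<open>p\<close>\<close>

locale prime_above = unramified_prime +
  fixes S :: "'a set"
  assumes S: "max_multiplicative S"
begin

lemma S_R: "s \<in> S \<Longrightarrow> s \<in> R"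
  and S_one: "1 \<in> S"
  and S_mult: "s \<in> S \<Longrightarrow> t \<in> S \<Longrightarrow> s * t \<in> S"
  and S_disjoint: "s \<in> S \<Longrightarrow> s \<notin> multiples R p"
  and S_compl: "r \<in> R \<Longrightarrow> r \<notin> S \<Longrightarrow> \<exists>s\<in>S. s * r \<in> multiples R p"
  using S by (auto simp: max_multiplicative_def)

lemma S_nonzero: "s \<in> S \<Longrightarrow> s \<noteq> 0"
  using S_disjoint[of 0] multiplesI[of 0] R_closed(1) by auto

text \<open>In the localization of \<open>R\<close> at \<open>S\<close> the elements of
  \<open>S\<close> are units, so \<open>f\<close> is \<open>p powi e\<close> times the unit
  \<open>t / s\<close>. Cross-multiplication avoids constructing that ring.\<close>

definition has_val :: "'a \<Rightarrow> int \<Rightarrow> bool" where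
  "has_val f e \<longleftrightarrow> (\<exists>s\<in>S. \<exists>t\<in>S. s * f = p powi e * t)"

text \<open>If \<open>e'\<close> exceeded \<open>e\<close>, cancelling \<open>p powi e\<close> would
  put a product of elements of \<open>S\<close> into \<open>p R\<close>.\<close>

lemma has_val_le:
  assumes "has_val f e" "has_val f e'"
  shows "e' \<le> e"
proof (rule ccontr)
  assume "\<not> e' \<le> e"
  then obtain n where n: "e' = e + 1 + int n" by (metis not_le zless_iff_Suc_zadd add.assoc of_nat_Suc add.commute)
  obtain s t s' t' where st: "s \<in> S" "t \<in> S" "s' \<in> S" "t' \<in> S"
    "s * f = p powi e * t" "s' * f = p powi e' * t'"
    using assms by (auto simp: has_val_def)
  have "p powi e * (s' * t) = s' * (s * f)" by (simp add: st)
  also have "\<dots> = s * (p powi e' * t')" by (simp add: st(6)[symmetric])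
  also have "\<dots> = p powi e * (p * (p ^ n * s * t'))"
    using p by (simp add: n power_int_add)
  finally have "s' * t = p * (p ^ n * s * t')" using p by simp
  moreover have "p ^ n * s * t' \<in> R" using st S_R p_R R_closed by auto
  ultimately show False using S_disjoint S_mult st multiplesI by metis
qed

lemma has_val_unique: "has_val f e \<Longrightarrow> has_val f e' \<Longrightarrow> e = e'"
  using has_val_le by (meson order_antisym)

text \<open>The value is the largest \<open>e\<close> such that some \<open>s * r\<close> with
  \<open>s\<close> in \<open>S\<close> is divisible by \<open>p ^ e\<close>. It is bounded by the
  exponent of \<open>p\<close> in a multiple of \<open>r\<close> lying in \<open>A\<close>. At the
  maximum the cofactor is in \<open>S\<close>: otherwise some element of \<open>S\<close> would
  produce one more factor \<open>p\<close>.\<close>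

lemma has_val_nonneg_exists:
  assumes r: "r \<in> R" "r \<noteq> 0"
  shows "\<exists>e\<ge>0. has_val r e"
proof -
  obtain r' where r': "r' \<in> R" "r * r' \<in> A" "r * r' \<noteq> 0" using norm r by blast
  obtain k b where kb: "r * r' = p ^ k * b" "b \<in> A" "b \<notin> multiples A p" using factor r' by blast
  obtain u w where uw: "u \<in> A" "w \<in> A" "u * b + w * p = 1" using bezout kb by blast
  define E where "E = {e. \<exists>s\<in>S. \<exists>q\<in>R. s * r = p ^ e * q}"
  have bound: "e \<le> k" if e: "e \<in> E" for e
  proof (rule ccontr)
    assume "\<not> e \<le> k"
    then obtain n where n: "e = k + Suc n" using less_imp_Suc_add not_le by (metis add_Suc_right)
    obtain s q where sq: "s \<in> S" "q \<in> R" "s * r = p ^ e * q" using e by (auto simp: E_def)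
    have "p ^ k * (s * b) = (s * r) * r'" using kb(1) by (simp add: mult_ac)
    also have "\<dots> = p ^ k * (p * (p ^ n * q * r'))" unfolding sq(3) by (simp add: n power_add)
    finally have "s * b = p * (p ^ n * q * r')" using p by simp
    moreover have "p ^ n * q * r' \<in> R" using sq p_R r' R_closed by auto
    ultimately have "s * b \<in> multiples R p" using multiplesI by auto
    \<comment> \<open>Bezout for \<open>b\<close> and \<open>p\<close> turns divisibility of
      \<open>s * b\<close> by \<open>p\<close> into divisibility of \<open>s\<close>.\<close>
    hence "u * (s * b) \<in> multiples R p" using multiples_mult[OF R] uw A_R by blast
    moreover have "p * (s * w) \<in> multiples R p" using uw A_R sq S_R R_closed by (intro multiplesI) auto
    ultimately have "u * (s * b) + p * (s * w) \<in> multiples R p" using multiples_add R by blast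
    moreover have "u * (s * b) + p * (s * w) = s * (u * b + w * p)" by (simp add: algebra_simps)
    ultimately have "s \<in> multiples R p" by (simp add: uw(3))
    thus False using S_disjoint sq by blast
  qed
  have fin: "finite E" using bound by (meson finite_nat_set_iff_bounded_le)
  have "0 \<in> E" using S_one r by (force simp: E_def)
  hence "Max E \<in> E" using fin Max_in by blast
  then obtain s q where sq: "s \<in> S" "q \<in> R" "s * r = p ^ Max E * q" by (auto simp: E_def)
  have "q \<in> S"
  proof (rule ccontr)
    assume "q \<notin> S"
    then obtain s' where s': "s' \<in> S" "s' * q \<in> multiples R p" using S_compl sq(2) by blast
    then obtain q' where q': "q' \<in> R" "s' * q = p * q'" unfolding multiples_def by blast
    have "(s' * s) * r = p ^ Max E * (s' * q)" by (simp add: sq(3) mult.assoc mult.left_commute)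
    also have "\<dots> = p ^ Suc (Max E) * q'" unfolding q'(2) by simp
    finally have "Suc (Max E) \<in> E" using sq(1) s'(1) q'(1) S_mult unfolding E_def by blast
    thus False using fin by (metis Max_ge Suc_n_not_le_n)
  qed
  hence "has_val r (int (Max E))" using sq by (auto simp: has_val_def)
  thus ?thesis by (metis of_nat_0_le_iff)
qed

lemma has_val_mult:
  assumes "has_val f e" "has_val g e'"
  shows "has_val (f * g) (e + e')"
proof -
  obtain s t s' t' where st: "s \<in> S" "t \<in> S" "s' \<in> S" "t' \<in> S"
    "s * f = p powi e * t" "s' * g = p powi e' * t'"
    using assms by (auto simp: has_val_def)
  have "(s * s') * (f * g) = (s * f) * (s' * g)" by (simp add: mult_ac)
  also have "\<dots> = p powi (e + e') * (t * t')" using p unfolding st by (simp add: power_int_add)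
  finally show ?thesis using st S_mult unfolding has_val_def by blast
qed

lemma has_val_inverse:
  assumes "f \<noteq> 0" "has_val f e"
  shows "has_val (inverse f) (- e)"
proof -
  obtain s t where st: "s \<in> S" "t \<in> S" "s * f = p powi e * t"
    using assms by (auto simp: has_val_def)
  have "t * inverse f = p powi (- e) * s"
    using st(3) assms(1) p by (simp add: power_int_minus field_simps)
  thus ?thesis using st unfolding has_val_def by blast
qed

lemma has_val_exists:
  assumes "f \<noteq> 0"
  shows "\<exists>e. has_val f e"
proof -
  obtain a where a: "a \<in> A" "a \<noteq> 0" "a * f \<in> R" using fraction by blast
  obtain e e' where "has_val (a * f) e" "has_val a e'"
    using has_val_nonneg_exists[of a] has_val_nonneg_exists[of "a * f"] a A_R assms by auto
  hence "has_val (inverse a * (a * f)) (- e' + e)" using a by (intro has_val_mult has_val_inverse)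
  thus ?thesis using a by (auto simp: mult.assoc[symmetric])
qed

text \<open>After factoring out the smaller power of \<open>p\<close> the numerator \<open>u\<close>
  lies in \<open>R\<close>, so its own value is nonnegative.\<close>

lemma has_val_add_aux:
  assumes "has_val f e" "has_val g e'" "f + g \<noteq> 0" "e \<le> e'"
  shows "\<exists>d\<ge>e. has_val (f + g) d"
proof -
  obtain s t s' t' where st: "s \<in> S" "t \<in> S" "s' \<in> S" "t' \<in> S"
    "s * f = p powi e * t" "s' * g = p powi e' * t'"
    using assms by (auto simp: has_val_def)
  obtain n where n: "e' = e + int n" using assms(4) by (metis zle_iff_zadd)
  define u where "u = s' * t + s * t' * p ^ n"
  have "(s * s') * (f + g) = s' * (s * f) + s * (s' * g)" by (simp add: algebra_simps)
  also have "\<dots> = p powi e * u" unfolding st using p by (simp add: u_def n power_int_add distrib_left mult_ac)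
  finally have eq: "(s * s') * (f + g) = p powi e * u" .
  have "u \<in> R" using st S_R p_R by (auto simp: u_def intro!: R_closed)
  moreover have "u \<noteq> 0" using eq assms(3) st S_nonzero by auto
  ultimately obtain d where d: "d \<ge> 0" "has_val u d" using has_val_nonneg_exists by blast
  then obtain a b where ab: "a \<in> S" "b \<in> S" "a * u = p powi d * b" by (auto simp: has_val_def)
  have "(a * (s * s')) * (f + g) = p powi e * (a * u)" using eq by (simp add: mult_ac)
  also have "\<dots> = p powi (e + d) * b" using ab p by (simp add: power_int_add mult_ac)
  finally have "has_val (f + g) (e + d)" using st ab S_mult unfolding has_val_def by blast
  thus ?thesis using d by (intro exI[of _ "e + d"]) auto
qed

lemma has_val_add:
  assumes "has_val f e" "has_val g e'" "f + g \<noteq> 0"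
  shows "\<exists>d\<ge>min e e'. has_val (f + g) d"
  using has_val_add_aux[of f e g e'] has_val_add_aux[of g e' f e] assms
  by (cases "e \<le> e'") (auto simp: add.commute min_def)

definition val :: "'a \<Rightarrow> int" where
  "val f = (if f = 0 then 0 else THE e. has_val f e)"

lemma val_eq: "f \<noteq> 0 \<Longrightarrow> has_val f e \<Longrightarrow> val f = e"
  unfolding val_def using has_val_unique by auto

lemma has_val_val: "f \<noteq> 0 \<Longrightarrow> has_val f (val f)"
  using has_val_exists val_eq by metis

lemma val_nonneg: "r \<in> R \<Longrightarrow> val r \<ge> 0"
  using has_val_nonneg_exists[of r] val_eq[of r] by (cases "r = 0") (auto simp: val_def)

lemma val_S: "s \<in> S \<Longrightarrow> val s = 0"
  using S_nonzero S_one val_eq[of s 0] unfolding has_val_def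
  by (metis mult.left_neutral mult.right_neutral power_int_0_right)

lemma val_p: "val p = 1"
  using p S_one by (intro val_eq) (auto simp: has_val_def)

lemma val_mult: "f \<noteq> 0 \<Longrightarrow> g \<noteq> 0 \<Longrightarrow> val (f * g) = val f + val g"
  using has_val_val has_val_mult val_eq by simp

lemma is_place_val:
  assumes "is_subfield K" "K \<subseteq> R"
  shows "is_place K val"
  unfolding is_place_def
proof (intro conjI ballI allI impI)
  show "val 0 = 0" by (simp add: val_def)
  show "val (f * g) = val f + val g" if "f \<noteq> 0 \<and> g \<noteq> 0" for f g
    using that val_mult by blast
  show "val (f + g) \<ge> min (val f) (val g)" if "f \<noteq> 0 \<and> g \<noteq> 0 \<and> f + g \<noteq> 0" for f g
    using that has_val_add[of f "val f" g "val g"] has_val_val val_eq by auto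
  show "val c = 0" if "c \<in> K" for c
  proof (cases "c = 0")
    case False
    \<comment> \<open>A nonzero constant and its inverse both lie in \<open>R\<close>, and their
      nonnegative values add up to 0.\<close>
    have "val c \<ge> 0" "val (inverse c) \<ge> 0"
      using that assms by (auto simp: is_subfield_def intro!: val_nonneg)
    moreover have "val (c * inverse c) = val c + val (inverse c)" using False by (intro val_mult) auto
    moreover have "val 1 = 0" using S_one val_S by blast
    ultimately show ?thesis using False by simp
  qed (simp add: val_def)
  show "\<exists>t. t \<noteq> 0 \<and> val t = 1" using p val_p by blast
qed

end

context unramified_prime
begin

text \<open>Choosing the maximal multiplicative set so that it contains \<open>g\<close> makes
  \<open>g\<close> a unit at the place.\<close>

lemma place_exists:
  assumes "is_subfield K" "K \<subseteq> R" "g \<in> R" "g \<notin> multiples R p"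
  obtains v where "is_place K v" "\<And>r. r \<in> R \<Longrightarrow> v r \<ge> 0" "v g = 0" "v p = 1"
proof -
  obtain S where S: "max_multiplicative S" and g: "g \<in> S" using max_multiplicative_exists assms by blast
  interpret prime_above A R p S by unfold_locales (rule S)
  show ?thesis using is_place_val[OF assms(1,2)] val_nonneg val_S[OF g] val_p by (rule that)
qed

end

section \<open>The polynomial ring of an element with a pole\<close>

definition poly_ring :: "'f::field set \<Rightarrow> 'f \<Rightarrow> 'f set" where
  "poly_ring K z = {poly q z | q. \<forall>i. coeff q i \<in> K}"

lemma is_subring_subfield: "is_subfield K \<Longrightarrow> is_subring K"
  by (auto simp: is_subfield_def is_subring_def)

lemma subset_poly_ring:
  assumes "is_subfield K"
  shows "K \<subseteq> poly_ring K z"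
proof
  fix c assume "c \<in> K"
  moreover have "poly [:c:] z = c" by simp
  moreover have "\<forall>i. coeff [:c:] i \<in> K"
    using \<open>c \<in> K\<close> assms by (auto simp: is_subfield_def coeff_pCons split: nat.splits)
  ultimately show "c \<in> poly_ring K z" unfolding poly_ring_def by (intro CollectI exI[of _ "[:c:]"]) simp
qed

lemma gen_in_poly_ring: "is_subfield K \<Longrightarrow> z \<in> poly_ring K z"
  unfolding poly_ring_def
  by (rule CollectI, rule exI[of _ "[:0, 1:]"])
    (auto simp: is_subfield_def coeff_pCons split: nat.splits)

lemma is_subring_poly_ring:
  assumes "is_subfield K"
  shows "is_subring (poly_ring K z)"
proof -
  note s = is_subringD[OF is_subring_subfield[OF assms]]
  have sum: "sum g I \<in> K" if "\<And>i. i \<in> I \<Longrightarrow> g i \<in> K" for g and I :: "nat set"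
    using that by (induction I rule: infinite_finite_induct) (auto intro: s)
  have "a - b \<in> poly_ring K z \<and> a * b \<in> poly_ring K z"
    if ab: "a \<in> poly_ring K z" "b \<in> poly_ring K z" for a b
  proof -
    obtain f g where fg: "a = poly f z" "b = poly g z" "\<forall>i. coeff f i \<in> K" "\<forall>i. coeff g i \<in> K"
      using ab by (auto simp: poly_ring_def)
    have "a - b = poly (f - g) z" "a * b = poly (f * g) z" by (simp_all add: fg)
    moreover have "\<forall>i. coeff (f - g) i \<in> K" "\<forall>i. coeff (f * g) i \<in> K"
      using fg by (auto simp: coeff_mult intro!: sum s)
    ultimately show ?thesis unfolding poly_ring_def by blast
  qed
  moreover have "0 \<in> poly_ring K z" "1 \<in> poly_ring K z"
    using subset_poly_ring[OF assms] s by auto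
  ultimately show ?thesis by (simp add: is_subring_def)
qed

text \<open>With a pole at \<open>z\<close>, the valuation is a negative multiple of the degree on
  \<open>K[z]\<close>. Division and gcds can thus be handled inside the field, although
  \<open>K\<close> is only a subset of it.\<close>

locale pole_ring = place K v for K :: "'f::field set" and v :: "'f \<Rightarrow> int" +
  fixes z :: 'f
  assumes K: "is_subfield K" and pole: "v z < 0"
begin

abbreviation A where "A \<equiv> poly_ring K z"

lemmas A_closed = is_subringD[OF is_subring_poly_ring[OF K]]

lemma z_nonzero: "z \<noteq> 0"
  using pole by auto

text \<open>In each Horner step \<open>c + z * poly q z\<close> with \<open>q\<close> nonzero, the
  second summand has negative value and dominates the constant. In particular \<open>z\<close> is
  transcendental over \<open>K\<close>.\<close>

lemma v_poly:
  assumes "q \<noteq> 0" "\<forall>i. coeff q i \<in> K"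
  shows "poly q z \<noteq> 0 \<and> v (poly q z) = int (degree q) * v z"
  using assms
proof (induction q)
  case (pCons c q)
  have cK: "c \<in> K" using pCons.prems(2) by (metis coeff_pCons_0)
  show ?case
  proof (cases "q = 0")
    case True
    thus ?thesis using pCons.prems cK v_const by auto
  next
    case False
    have "\<forall>i. coeff q i \<in> K" using pCons.prems(2) by (metis coeff_pCons_Suc)
    hence IH: "poly q z \<noteq> 0" "v (poly q z) = int (degree q) * v z" using pCons.IH False by auto
    hence vz: "z * poly q z \<noteq> 0" "v (z * poly q z) = int (Suc (degree q)) * v z"
      using z_nonzero by (auto simp: v_mult algebra_simps)
    have "v (z * poly q z) < 0" using pole by (simp add: vz(2) mult_pos_neg)
    thus ?thesis using v_add_eq[of "z * poly q z" c] vz v_const[OF cK] False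
      by (cases "c = 0") (auto simp: add.commute)
  qed
qed simp

lemma A_degree:
  assumes "a \<in> A" "a \<noteq> 0"
  shows "\<exists>k. v a = int k * v z"
proof -
  obtain q where q: "a = poly q z" "\<forall>i. coeff q i \<in> K" using assms by (auto simp: poly_ring_def)
  moreover from this have "q \<noteq> 0" using assms by auto
  ultimately show ?thesis using v_poly[of q] by blast
qed

lemma v_A: "a \<in> A \<Longrightarrow> a \<noteq> 0 \<Longrightarrow> v a \<le> 0"
  using A_degree[of a] pole by (auto simp: mult_le_0_iff)

lemma A_unit:
  assumes "a \<in> A" "a \<noteq> 0" "v a = 0"
  shows "inverse a \<in> A"
proof -
  obtain q where q: "a = poly q z" "\<forall>i. coeff q i \<in> K" using assms by (auto simp: poly_ring_def)
  hence "q \<noteq> 0" using assms by auto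
  hence "degree q = 0" using v_poly[of q] q assms pole by auto
  then obtain c where "q = [:c:]" by (meson degree_eq_zeroE)
  hence "a \<in> K" using q by (metis coeff_pCons_0 poly_pCons add.right_neutral mult_zero_right poly_0)
  hence "inverse a \<in> K" using K by (simp add: is_subfield_def)
  thus ?thesis using subset_poly_ring[OF K] by blast
qed

text \<open>Long division, by induction on a bound \<open>n\<close> for the number of coefficients
  of \<open>f\<close>. A larger value of \<open>v\<close> means a smaller degree.\<close>

lemma euclid_poly:
  assumes "\<forall>i. coeff f i \<in> K" "\<forall>i\<ge>n. coeff f i = 0" "b \<in> A" "b \<noteq> 0"
  shows "\<exists>q\<in>A. poly f z - q * b = 0 \<or> v (poly f z - q * b) > v b"
  using assms(1,2)
proof (induction n arbitrary: f)
  case 0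
  hence "f = 0" by (simp add: poly_eq_iff)
  thus ?case using A_closed(1) by (intro bexI[of _ 0]) auto
next
  case (Suc n)
  obtain g where g: "b = poly g z" "\<forall>i. coeff g i \<in> K" using assms by (auto simp: poly_ring_def)
  hence g0: "g \<noteq> 0" using assms by auto
  show ?case
  proof (cases "n < degree g")
    case True
    have "v (poly f z) > v b" if f: "f \<noteq> 0"
    proof -
      have "degree f \<le> n" using Suc.prems(2) f by (metis leading_coeff_0_iff not_less_eq_eq)
      hence "degree f < degree g" using True by simp
      thus ?thesis using v_poly[of f] v_poly[of g] f g g0 Suc.prems pole by (simp add: mult_less_cancel_right)
    qed
    hence "poly f z - 0 * b = 0 \<or> v (poly f z - 0 * b) > v b" by (cases "f = 0") auto
    thus ?thesis using A_closed(1) by blast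
  next
    case False
    define c where "c = coeff f n / lead_coeff g"
    define h where "h = monom c (n - degree g)"
    have cK: "c \<in> K" using Suc.prems g K by (auto simp: c_def is_subfield_def divide_inverse)
    hence hK: "\<forall>i. coeff h i \<in> K" using K by (auto simp: h_def is_subfield_def)
    have coeff: "coeff (f - h * g) i = coeff f i - (if n - degree g \<le> i then c * coeff g (i - (n - degree g)) else 0)" for i
      by (simp add: h_def coeff_monom_mult)
    have "coeff (f - h * g) i = 0" if i: "i \<ge> n" for i
    proof (cases "i = n")
      case True
      thus ?thesis using g0 False unfolding coeff by (simp add: c_def)
    next
      case i': False
      hence "coeff f i = 0" "coeff g (i - (n - degree g)) = 0" using i Suc.prems False
        by (auto intro!: coeff_eq_0)
      thus ?thesis unfolding coeff by simp
    qed
    moreover have "\<forall>i. coeff (f - h * g) i \<in> K"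
      unfolding coeff using Suc.prems g cK K by (auto simp: is_subfield_def)
    ultimately obtain q where q: "q \<in> A"
      "poly (f - h * g) z - q * b = 0 \<or> v (poly (f - h * g) z - q * b) > v b"
      using Suc.IH[of "f - h * g"] by blast
    have eq: "poly (f - h * g) z - q * b = poly f z - (q + poly h z) * b"
      by (simp add: g algebra_simps)
    have "poly h z \<in> A" using hK by (auto simp: poly_ring_def)
    hence "q + poly h z \<in> A" using q(1) A_closed(5) by blast
    thus ?thesis using q(2) unfolding eq by blast
  qed
qed

lemma euclid:
  assumes "a \<in> A" "b \<in> A" "b \<noteq> 0"
  shows "\<exists>q\<in>A. a - q * b = 0 \<or> v (a - q * b) > v b"
proof -
  obtain f where f: "a = poly f z" "\<forall>i. coeff f i \<in> K" using assms by (auto simp: poly_ring_def)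
  show ?thesis unfolding f(1)
    by (rule euclid_poly[of _ "Suc (degree f)"]) (use f assms in \<open>auto intro!: coeff_eq_0\<close>)
qed

text \<open>A nonzero element of least degree in the ideal generated by \<open>a\<close> and
  \<open>p\<close> divides every element of that ideal.\<close>

lemma gcd_exists:
  assumes "a \<in> A" "p \<in> A" "p \<noteq> 0"
  shows "\<exists>d\<in>A. d \<noteq> 0 \<and> a \<in> multiples A d \<and> p \<in> multiples A d \<and> (\<exists>u\<in>A. \<exists>w\<in>A. d = u * a + w * p)"
proof -
  define I where "I = {u * a + w * p | u w. u \<in> A \<and> w \<in> A}"
  define Q where "Q d \<longleftrightarrow> d \<in> I \<and> d \<noteq> 0" for d
  have "0 * a + 1 * p \<in> I" "1 * a + 0 * p \<in> I" unfolding I_def using A_closed(1,2) by blast+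
  hence pI: "p \<in> I" and aI: "a \<in> I" by auto
  obtain d where d: "Q d" and min: "\<And>e. Q e \<Longrightarrow> nat (- v d) \<le> nat (- v e)"
    using ex_has_least_nat[of Q p "\<lambda>e. nat (- v e)"] pI assms(3) by (auto simp: Q_def)
  have IA: "I \<subseteq> A" using assms by (auto simp: I_def intro!: A_closed)
  have dvd: "c \<in> multiples A d" if c: "c \<in> I" for c
  proof -
    obtain q where q: "q \<in> A" "c - q * d = 0 \<or> v (c - q * d) > v d"
      using euclid[of c d] c d IA by (auto simp: Q_def)
    have "c - q * d \<in> I"
    proof -
      obtain u w u' w' where uw: "c = u * a + w * p" "d = u' * a + w' * p"
        "u \<in> A" "w \<in> A" "u' \<in> A" "w' \<in> A" using c d unfolding Q_def I_def by auto
      have "c - q * d = (u - q * u') * a + (w - q * w') * p" by (simp add: uw algebra_simps)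
      moreover have "u - q * u' \<in> A" "w - q * w' \<in> A" using uw q by (auto intro!: A_closed)
      ultimately show ?thesis unfolding I_def by blast
    qed
    moreover have False if "c - q * d \<noteq> 0"
    proof -
      have "Q (c - q * d)" using that calculation by (simp add: Q_def)
      hence "nat (- v d) \<le> nat (- v (c - q * d))" "v (c - q * d) \<le> 0"
        using min v_A IA by (auto simp: Q_def)
      thus False using q that by auto
    qed
    ultimately have "c = d * q" by (auto simp: mult.commute)
    thus ?thesis using q by (auto simp: multiples_def)
  qed
  show ?thesis using dvd[OF pI] dvd[OF aI] d IA by (intro bexI[of _ d]) (auto simp: Q_def I_def)
qed

text \<open>A nonconstant divisor \<open>p\<close> of \<open>a\<close> of least degree is prime. For
  \<open>c\<close> not divisible by \<open>p\<close>, the gcd of \<open>c\<close> and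
  \<open>p\<close> is shown to be constant, and dividing by it gives the Bezout identity.\<close>

lemma prime_factor_exists:
  assumes a: "a \<in> A" "a \<noteq> 0" "v a < 0"
  shows "\<exists>p\<in>A. p \<noteq> 0 \<and> v p < 0 \<and> a \<in> multiples A p \<and>
    (\<forall>c\<in>A. c \<notin> multiples A p \<longrightarrow> (\<exists>u\<in>A. \<exists>w\<in>A. u * c + w * p = 1))"
proof -
  define Q where "Q p \<longleftrightarrow> p \<in> A \<and> p \<noteq> 0 \<and> v p < 0 \<and> a \<in> multiples A p" for p
  have "a = a * 1" by simp
  hence "Q a" using a A_closed(2) unfolding Q_def multiples_def by blast
  then obtain p where p: "Q p" and min: "\<And>d. Q d \<Longrightarrow> nat (- v p) \<le> nat (- v d)"
    using ex_has_least_nat[of Q a "\<lambda>e. nat (- v e)"] by auto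
  have "\<exists>u\<in>A. \<exists>w\<in>A. u * c + w * p = 1" if c: "c \<in> A" "c \<notin> multiples A p" for c
  proof -
    obtain d u w where d: "d \<in> A" "d \<noteq> 0" "c \<in> multiples A d" "p \<in> multiples A d"
      "u \<in> A" "w \<in> A" "d = u * c + w * p"
      using gcd_exists[of c p] c p by (auto simp: Q_def)
    obtain d' where d': "p = d * d'" "d' \<in> A" using d by (auto simp: multiples_def)
    have d'0: "d' \<noteq> 0" using d' p by (auto simp: Q_def)
    have vp: "v p = v d + v d'" unfolding d'(1) using d(2) d'0 by (rule v_mult)
    have "v d = 0"
    proof (rule ccontr)
      assume "v d \<noteq> 0"
      hence vd: "v d < 0" using v_A d by force
      obtain r where "a = p * r" "r \<in> A" using p by (auto simp: Q_def multiples_def)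
      hence "a = d * (d' * r)" "d' * r \<in> A" using d' A_closed by auto
      hence "Q d" using d vd by (auto simp: Q_def multiples_def)
      \<comment> \<open>A nonconstant \<open>d\<close> would also divide \<open>a\<close>, so by
        minimality it has the degree of \<open>p\<close> and differs from \<open>p\<close> by a
        unit; then \<open>p\<close> would divide \<open>c\<close>.\<close>
      hence "v d' = 0" using min[of d] vp v_A[OF d'(2) d'0] vd by auto
      hence inv: "inverse d' \<in> A" using A_unit d' d'0 by blast
      obtain e where "c = d * e" "e \<in> A" using d by (auto simp: multiples_def)
      hence "c = p * (inverse d' * e)" using d' d'0 by simp
      moreover have "inverse d' * e \<in> A" using inv \<open>e \<in> A\<close> A_closed by auto
      ultimately show False using c by (auto simp: multiples_def)
    qed
    hence inv: "inverse d \<in> A" using A_unit d by blast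
    have "(inverse d * u) * c + (inverse d * w) * p = inverse d * (u * c + w * p)"
      by (simp add: algebra_simps)
    also have "\<dots> = 1" using d(2) d(7)[symmetric] by simp
    finally have "(inverse d * u) * c + (inverse d * w) * p = 1" .
    thus ?thesis using inv d A_closed(4) by blast
  qed
  thus ?thesis using p by (auto simp: Q_def)
qed

lemma power_factor:
  assumes p: "p \<in> A" "p \<noteq> 0" "v p < 0" and a: "a \<in> A" "a \<noteq> 0"
  shows "\<exists>k. \<exists>b\<in>A. a = p ^ k * b \<and> b \<notin> multiples A p"
  using a
proof (induction "nat (- v a)" arbitrary: a rule: less_induct)
  case less
  show ?case
  proof (cases "a \<in> multiples A p")
    case False
    thus ?thesis using less.prems by (intro exI[of _ 0]) auto
  next
    case True
    then obtain r where r: "a = p * r" "r \<in> A" by (auto simp: multiples_def)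
    hence "r \<noteq> 0" using less.prems by auto
    hence "v a = v p + v r" using r p by (simp add: v_mult)
    hence "nat (- v r) < nat (- v a)" using p v_A[OF r(2) \<open>r \<noteq> 0\<close>] by auto
    then obtain k b where "b \<in> A" "r = p ^ k * b" "b \<notin> multiples A p"
      using less.hyps r \<open>r \<noteq> 0\<close> by blast
    thus ?thesis using r by (intro exI[of _ "Suc k"] bexI[of _ b]) auto
  qed
qed

lemma reduced_mod_bezout:
  assumes "p \<in> A" and "\<And>c. c \<in> A \<Longrightarrow> c \<notin> multiples A p \<Longrightarrow> \<exists>u\<in>A. \<exists>w\<in>A. u * c + w * p = 1"
  shows "reduced_mod A p"
  unfolding reduced_mod_def
proof (intro ballI impI)
  fix r assume r: "r \<in> A" "r ^ 2 \<in> multiples A p"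
  show "r \<in> multiples A p"
  proof (rule ccontr)
    assume nr: "r \<notin> multiples A p"
    then obtain u w where uw: "u \<in> A" "w \<in> A" "u * r + w * p = 1" using assms r by blast
    obtain q where q: "q \<in> A" "r ^ 2 = p * q" using r by (auto simp: multiples_def)
    have "r = (u * r + w * p) * r" using uw by simp
    also have "\<dots> = u * r ^ 2 + p * (w * r)" by (simp add: algebra_simps power2_eq_square)
    also have "\<dots> = p * (u * q + w * r)" by (simp add: q algebra_simps)
    finally have "r = p * (u * q + w * r)" .
    moreover have "u * q + w * r \<in> A" using uw q r by (auto intro!: A_closed)
    ultimately show False using nr by (auto simp: multiples_def)
  qed
qed

end

section \<open>The function field of the curve\<close>

text \<open>This descends one step of the tower: the value of an element is that of its dominant
  term.\<close>

lemma (in place) v_adjoin_cases: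
  assumes "\<forall>u\<in>B. 2 * d dvd v u" "\<not> 2 * d dvd v x" "d dvd v x" "x \<noteq> 0" "a \<in> adjoin B x" "a \<noteq> 0"
  shows "\<exists>u\<in>B. u \<noteq> 0 \<and> (v a = v u \<or> v a = v u + v x)"
proof -
  obtain b c where bc: "a = b + c * x" "b \<in> B" "c \<in> B" using assms by (auto simp: adjoin_def)
  show ?thesis
  proof (cases "b = 0 \<or> c = 0")
    case True
    thus ?thesis using bc assms(4,6) by (auto simp: v_mult)
  next
    case False
    hence "v a = min (v b) (v c + v x)" using adjoin_valuation(3)[OF assms(1-4) bc(2,3)] bc(1) by auto
    thus ?thesis using bc False by (metis min_def)
  qed
qed

locale curve = place K v for K :: "'f::field set" and v :: "'f \<Rightarrow> int" +
  fixes x y z :: 'f and m :: nat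
  assumes K: "is_subfield K" and two: "(2::'f) = 0"
    and eq_x: "x ^ 2 + x = y ^ 3" and eq_y: "y ^ 4 - y = z ^ m"
    and m: "odd m" and z_nz: "z \<noteq> 0"
    and infinite: "v x < 0 \<or> v y < 0 \<or> v z < 0"
    and generated: "\<And>L. is_subfield L \<Longrightarrow> K \<subseteq> L \<Longrightarrow> {x, y, z} \<subseteq> L \<Longrightarrow> L = UNIV"
begin

lemma minus_eq [simp]: "- (a::'f) = a"
proof -
  have "a + a = 0" using two by (metis mult_2 mult_zero_left)
  thus ?thesis by (simp add: eq_neg_iff_add_eq_0 add_eq_0_iff)
qed

lemma y_nz: "y \<noteq> 0"
  using eq_y z_nz by auto

lemma x_nz: "x \<noteq> 0"
  using eq_x y_nz by auto

text \<open>The two equations force a pole of \<open>y\<close> as soon as one of \<open>x\<close>,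
  \<open>y\<close>, \<open>z\<close> has a pole, and then \<open>2 * v x = 3 * v y\<close> and
  \<open>4 * v y = m * v z\<close>. The factor \<open>t\<close> is left open here.\<close>

lemma valuations: "\<exists>t>0. v z = -8 * t \<and> v y = -2 * int m * t \<and> v x = -3 * int m * t"
proof -
  have rhs_x: "x ^ 2 - x = y ^ 3" using eq_x minus_eq[of x] by (metis diff_conv_add_uminus)
  have vx: "v x < 0 \<Longrightarrow> 2 * v x = 3 * v y" "v x \<ge> 0 \<Longrightarrow> v y \<ge> 0"
    using v_artin_schreier[of x 2] x_nz y_nz rhs_x v_power[of y 3] by auto
  have vy: "v y < 0 \<Longrightarrow> 4 * v y = int m * v z" "v y \<ge> 0 \<Longrightarrow> int m * v z \<ge> 0"
    using v_artin_schreier[of y 4] z_nz y_nz eq_y v_power[of z m] by auto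
  have m0: "int m > 0" using m odd_pos by simp
  have "v y < 0"
    using vx vy infinite m0 by (smt (verit) zero_le_mult_iff)
  moreover from this have "v x < 0" using vx(2) by linarith
  ultimately have eqs: "2 * v x = 3 * v y" "4 * v y = int m * v z" using vx vy by auto
  \<comment> \<open>As \<open>m\<close> is odd, the second relation gives \<open>4 dvd v z\<close>,
    and the first one supplies the remaining factor 2.\<close>
  have "coprime 4 (int m)" using m by (metis coprime_power_left_iff coprime_left_2_iff_odd even_of_nat numeral_Bit0 mult_2 power2_eq_square num_double numeral_times_numeral zero_less_numeral)
  moreover have "4 dvd int m * v z" using eqs(2) by (metis dvd_triv_left)
  ultimately have "4 dvd v z" by (simp add: coprime_dvd_mult_right_iff)
  then obtain s where s: "v z = 4 * s" by blast
  hence vys: "v y = int m * s" using eqs(2) by simp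
  have "even (3 * int m * s)" using eqs(1) vys by (metis dvd_triv_left mult.assoc)
  hence "even s" using m by auto
  then obtain t where t: "s = 2 * t" by blast
  have "v z = -8 * (- t) \<and> v y = -2 * int m * (- t) \<and> v x = -3 * int m * (- t)"
    using s t vys eqs(1) by simp
  moreover have "- t > 0" using \<open>v y < 0\<close> vys t m0 by (auto simp: mult_less_0_iff)
  ultimately show ?thesis by blast
qed

text \<open>The common factor of the pole orders, fixed by choice; normalization of \<open>v\<close>
  will show that it is 1.\<close>

definition t :: int where
  "t = (SOME t. t > 0 \<and> v z = -8 * t \<and> v y = -2 * int m * t \<and> v x = -3 * int m * t)"

lemma t: "t > 0" "v z = -8 * t" "v y = -2 * int m * t" "v x = -3 * int m * t"
  using someI_ex[OF valuations] by (auto simp: t_def)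

end

sublocale curve \<subseteq> pole_ring K v z
  by unfold_locales (use K t in auto)

section \<open>The ring \<open>R\<close> as a tower over \<open>K[z]\<close>\<close>

context curve
begin

definition w where "w = y ^ 2 + y"
definition R1 where "R1 = adjoin A w"
definition R2 where "R2 = adjoin R1 y"
definition R where "R = adjoin R2 x"

lemma w_eq: "w ^ 2 = w + z ^ m"
proof -
  have "w ^ 2 = y ^ 4 + y ^ 2 + 2 * y ^ 3"
    by (simp add: w_def power2_eq_square power3_eq_cube power4_eq_xxxx algebra_simps)
  also have "\<dots> = w + (y ^ 4 - y)" using two by (simp add: w_def)
  finally show ?thesis by (simp only: eq_y)
qed

lemma y_eq: "y ^ 2 = y + w"
proof -
  have "y ^ 2 = y ^ 2 + 2 * y" using two by simp
  thus ?thesis by (simp add: w_def algebra_simps)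
qed

lemma x_eq: "x ^ 2 = x + y ^ 3"
  using eq_x minus_eq[of x] by (metis add.commute eq_diff_eq diff_conv_add_uminus)

lemma v_w: "v w = -4 * int m * t" and w_nz: "w \<noteq> 0"
proof -
  have "v (y ^ 2) < v y" using t m odd_pos y_nz by (simp add: v_power mult_less_0_iff)
  thus "v w = -4 * int m * t" "w \<noteq> 0" using v_add_eq[of "y ^ 2" y] y_nz t by (auto simp: w_def v_power)
qed

lemma A_subring: "is_subring A"
  using K by (rule is_subring_poly_ring)

lemma zm_A: "z ^ m \<in> A"
  using gen_in_poly_ring[OF K] A_closed(7) by blast

lemma R1_subring: "is_subring R1"
  unfolding R1_def using A_subring w_eq zm_A by (rule is_subring_adjoin)

lemma w_R1: "w \<in> R1"
  unfolding R1_def using A_subring by (rule gen_in_adjoin)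

lemma R2_subring: "is_subring R2"
  unfolding R2_def using R1_subring y_eq w_R1 by (rule is_subring_adjoin)

lemma y_R2: "y \<in> R2"
  unfolding R2_def using R1_subring by (rule gen_in_adjoin)

lemma y3_R2: "y ^ 3 \<in> R2"
  using y_R2 is_subringD(7)[OF R2_subring] by blast

lemma R_subring: "is_subring R"
  unfolding R_def using R2_subring x_eq y3_R2 by (rule is_subring_adjoin)

lemmas R_closed = is_subringD[OF R_subring]

lemma x_R: "x \<in> R"
  unfolding R_def using R2_subring by (rule gen_in_adjoin)

lemma A_R1: "A \<subseteq> R1" and R1_R2: "R1 \<subseteq> R2" and R2_R: "R2 \<subseteq> R"
  using subset_adjoin[OF A_subring] subset_adjoin[OF R1_subring] subset_adjoin[OF R2_subring]
  unfolding R1_def R2_def R_def by blast+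

lemma A_R: "A \<subseteq> R"
  using A_R1 R1_R2 R2_R by blast

lemma dvd_v_A: "\<forall>a\<in>A. 2 * (4 * t) dvd v a"
proof
  fix a assume "a \<in> A"
  thus "2 * (4 * t) dvd v a" using A_degree[of a] t(2) by (cases "a = 0") auto
qed

text \<open>The values of \<open>w\<close>, \<open>y\<close>, \<open>x\<close> are odd multiples of
  \<open>4 * t\<close>, \<open>2 * t\<close>, \<open>t\<close>, which is what
  \<open>adjoin_valuation\<close> requires at the three steps of the tower.\<close>

lemma odd_dvd: "\<not> 2 * (4 * t) dvd v w" "4 * t dvd v w"
  "\<not> 2 * (2 * t) dvd v y" "2 * t dvd v y"
  "\<not> 2 * t dvd v x" "t dvd v x"
proof -
  have *: "\<not> 2 * s dvd s * c" if "odd c" "s \<noteq> 0" for s c :: int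
    using that by (metis dvd_times_left_cancel_iff mult.commute)
  have "v w = 4 * t * - int m" "v y = 2 * t * - int m" "v x = t * (- 3 * int m)"
    using t v_w by simp_all
  thus "\<not> 2 * (4 * t) dvd v w" "4 * t dvd v w" "\<not> 2 * (2 * t) dvd v y" "2 * t dvd v y"
    "\<not> 2 * t dvd v x" "t dvd v x"
    using *[of "- int m"] *[of "- 3 * int m"] t(1) m by (metis dvd_triv_left even_minus even_mult_iff
      even_of_nat mult_eq_0_iff odd_numeral order_less_irrefl zero_neq_numeral)+
qed

lemma dvd_v_R1: "\<forall>a\<in>R1. 2 * (2 * t) dvd v a"
  using adjoin_valuation(2)[OF dvd_v_A odd_dvd(1,2) w_nz] by (auto simp: R1_def adjoin_def)

lemma dvd_v_R2: "\<forall>a\<in>R2. 2 * t dvd v a"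
  using adjoin_valuation(2)[OF dvd_v_R1 odd_dvd(3,4) y_nz] by (auto simp: R2_def adjoin_def)

lemma dvd_v_R: "\<forall>a\<in>R. t dvd v a"
  using adjoin_valuation(2)[OF dvd_v_R2 odd_dvd(5,6) x_nz] by (auto simp: R_def adjoin_def)

lemma reduced_R:
  assumes "p \<in> A" "reduced_mod A p"
  shows "reduced_mod R p"
proof -
  have "reduced_mod R1 p" unfolding R1_def
    using A_subring w_eq zm_A two adjoin_valuation(1)[OF dvd_v_A odd_dvd(1,2) w_nz] assms(2,1)
    by (rule reduced_mod_adjoin)
  moreover have p: "p \<in> R1" "p \<in> R2" using assms A_R1 R1_R2 by auto
  ultimately have "reduced_mod R2 p" unfolding R2_def
    using reduced_mod_adjoin[OF R1_subring y_eq w_R1 two adjoin_valuation(1)[OF dvd_v_R1 odd_dvd(3,4) y_nz]]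
    by blast
  thus ?thesis unfolding R_def using p
      reduced_mod_adjoin[OF R2_subring x_eq y3_R2 two adjoin_valuation(1)[OF dvd_v_R2 odd_dvd(5,6) x_nz]]
    by blast
qed

text \<open>Multiplying by one conjugate per step leads from \<open>R\<close> through
  \<open>R2\<close> and \<open>R1\<close> down to \<open>A\<close>.\<close>

lemma norm_R:
  assumes r: "r \<in> R" "r \<noteq> 0"
  shows "\<exists>r'\<in>R. r * r' \<in> A \<and> r * r' \<noteq> 0"
proof -
  obtain a where a: "a \<in> R" "r * a \<in> R2" "r * a \<noteq> 0"
    using adjoin_norm[OF R2_subring x_eq y3_R2 two] r unfolding R_def by blast
  obtain b where b: "b \<in> R2" "r * a * b \<in> R1" "r * a * b \<noteq> 0"
    using adjoin_norm[OF R1_subring y_eq w_R1 two] a(2,3) unfolding R2_def by blast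
  obtain c where c: "c \<in> R1" "r * a * b * c \<in> A" "r * a * b * c \<noteq> 0"
    using adjoin_norm[OF A_subring w_eq zm_A two] b(2,3) unfolding R1_def by blast
  have "a * (b * c) \<in> R" using a b c R1_R2 R2_R by (intro R_closed(4)) auto
  thus ?thesis using c by (intro bexI[of _ "a * (b * c)"]) (auto simp: mult.assoc)
qed

text \<open>The elements with a denominator in \<open>A\<close> form a subfield, with inverses
  supplied by \<open>norm_R\<close>. It contains \<open>K\<close>, \<open>x\<close>,
  \<open>y\<close>, \<open>z\<close> and is therefore the whole field.\<close>

lemma fraction_R: "\<exists>a\<in>A. a \<noteq> 0 \<and> a * f \<in> R"
proof -
  define L where "L = {f. \<exists>a\<in>A. a \<noteq> 0 \<and> a * f \<in> R}"
  have R_L: "R \<subseteq> L"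
  proof
    fix r assume "r \<in> R"
    thus "r \<in> L" using A_closed(2) unfolding L_def by (intro CollectI bexI[of _ 1]) auto
  qed
  have op: "f - g \<in> L \<and> f * g \<in> L" if fg: "f \<in> L" "g \<in> L" for f g
  proof -
    obtain a b where ab: "a \<in> A" "a \<noteq> 0" "a * f \<in> R" "b \<in> A" "b \<noteq> 0" "b * g \<in> R"
      using fg by (auto simp: L_def)
    have abR: "a \<in> R" "b \<in> R" using ab A_R by auto
    have "a * b * (f - g) = b * (a * f) - a * (b * g)" "a * b * (f * g) = (a * f) * (b * g)"
      by (simp_all only: right_diff_distrib mult_ac)
    hence "a * b * (f - g) \<in> R" "a * b * (f * g) \<in> R"
      using R_closed(3,4) ab(3,6) abR by presburger+
    moreover have "a * b \<in> A" "a * b \<noteq> 0" using ab A_closed(4) by auto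
    ultimately show ?thesis unfolding L_def by blast
  qed
  have inv: "inverse f \<in> L" if f: "f \<in> L" for f
  proof (cases "f = 0")
    case True
    thus ?thesis using f by simp
  next
    case False
    obtain a where a: "a \<in> A" "a \<noteq> 0" "a * f \<in> R" using f by (auto simp: L_def)
    obtain r where r: "r \<in> R" "a * f * r \<in> A" "a * f * r \<noteq> 0" using norm_R[of "a * f"] a False by auto
    have "(a * f * r) * inverse f = a * r" using False by simp
    moreover have "a * r \<in> R" using a r A_R by (auto intro: R_closed)
    ultimately have "(a * f * r) * inverse f \<in> R" by (simp only:)
    thus ?thesis using r(2,3) unfolding L_def by (intro CollectI bexI[of _ "a * f * r"] conjI)
  qed
  have "is_subfield L"
    using op inv R_L R_closed(1,2) by (auto simp: is_subfield_def)
  moreover have "K \<subseteq> L" using subset_poly_ring[OF K] A_R R_L by blast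
  moreover have "{x, y, z} \<subseteq> L"
    using x_R y_R2 R2_R gen_in_poly_ring[OF K] A_R R_L by blast
  ultimately have "L = UNIV" by (rule generated)
  thus ?thesis by (auto simp: L_def)
qed

text \<open>\<open>t\<close> divides all values on \<open>R\<close>, hence on its quotients, hence
  the value 1 of a uniformizer. This is total ramification at infinity.\<close>

lemma t_eq_1: "t = 1"
proof -
  have "t dvd v f" for f
  proof (cases "f = 0")
    case False
    obtain a where a: "a \<in> A" "a \<noteq> 0" "a * f \<in> R" using fraction_R by blast
    have "v f = v (a * f) - v a" using a False by (simp add: v_mult)
    thus ?thesis using dvd_v_R a A_R by auto
  qed simp
  moreover obtain f where "v f = 1" using place by (auto simp: is_place_def)
  ultimately have "t dvd 1" by metis
  thus ?thesis using t(1) by auto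
qed

lemma v_xyz: "v z = -8" "v y = -2 * int m" "v x = -3 * int m" "v w = -4 * int m"
  using t t_eq_1 v_w by auto

lemma pole_order_A: "a \<in> A \<Longrightarrow> a \<noteq> 0 \<Longrightarrow> \<exists>k. - v a = 8 * int k"
  using A_degree[of a] v_xyz by auto

lemma pole_order_R:
  assumes "a \<in> R" "a \<noteq> 0"
  shows "\<exists>i\<le>1. \<exists>j\<le>3. \<exists>k. - v a = int (3 * i * m + 2 * j * m + 8 * k)"
proof -
  obtain b where b: "b \<in> R2" "b \<noteq> 0" "v a = v b \<or> v a = v b + v x"
    using v_adjoin_cases[OF dvd_v_R2 odd_dvd(5,6) x_nz] assms unfolding R_def by blast
  obtain c where c: "c \<in> R1" "c \<noteq> 0" "v b = v c \<or> v b = v c + v y"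
    using v_adjoin_cases[OF dvd_v_R1 odd_dvd(3,4) y_nz] b unfolding R2_def by blast
  obtain d where d: "d \<in> A" "d \<noteq> 0" "v c = v d \<or> v c = v d + v w"
    using v_adjoin_cases[OF dvd_v_A odd_dvd(1,2) w_nz] c unfolding R1_def by blast
  obtain k where k: "- v d = 8 * int k" using pole_order_A d by blast
  define i where "i = (if v a = v b then 0 else 1::nat)"
  \<comment> \<open>The generator \<open>w\<close> contributes 2 to \<open>j\<close>, since its pole
    order is that of \<open>y ^ 2\<close>.\<close>
  define j where "j = (if v b = v c then 0 else 1::nat) + (if v c = v d then 0 else 2)"
  have "- v a = int (3 * i * m + 2 * j * m + 8 * k)"
    using b(3) c(3) d(3) k v_xyz unfolding i_def j_def by (auto split: if_splits)
  moreover have "i \<le> 1" "j \<le> 3" by (auto simp: i_def j_def)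
  ultimately show ?thesis by blast
qed

text \<open>Clear the denominator of \<open>f\<close> by an element \<open>a\<close> of least degree and take a prime divisor \<open>p\<close>
  of \<open>a\<close>: the numerator \<open>a f\<close> is not divisible by \<open>p\<close>, so \<open>f\<close> has a pole above \<open>p\<close>.\<close>

lemma pole_exists:
  assumes f: "f \<notin> R"
  shows "\<exists>Q. is_place K Q \<and> Q z \<ge> 0 \<and> Q f < 0"
proof -
  define D where "D a \<longleftrightarrow> a \<in> A \<and> a \<noteq> 0 \<and> a * f \<in> R" for a
  obtain a0 where "D a0" using fraction_R D_def by blast
  then obtain a where a: "D a" and min: "\<And>b. D b \<Longrightarrow> nat (- v a) \<le> nat (- v b)"
    using ex_has_least_nat[of D a0 "\<lambda>e. nat (- v e)"] by auto
  have "v a < 0"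
  proof (rule ccontr)
    assume "\<not> v a < 0"
    hence "inverse a \<in> A" using A_unit v_A a by (force simp: D_def)
    hence "inverse a * (a * f) \<in> R" using a A_R by (auto simp: D_def intro: R_closed)
    moreover have "inverse a * (a * f) = f" using a by (simp add: D_def mult.assoc[symmetric])
    ultimately show False using f by simp
  qed
  then obtain p where p: "p \<in> A" "p \<noteq> 0" "v p < 0" "a \<in> multiples A p"
    and bez: "\<And>c. c \<in> A \<Longrightarrow> c \<notin> multiples A p \<Longrightarrow> \<exists>u\<in>A. \<exists>w\<in>A. u * c + w * p = 1"
    using prime_factor_exists[of a] a unfolding D_def by blast
  interpret U: unramified_prime A R p
    using A_subring R_subring A_R p(1,2) reduced_R[OF p(1) reduced_mod_bezout[OF p(1) bez]] bez
      power_factor[OF p(1-3)] norm_R fraction_R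
    by unfold_locales blast+
  obtain b where b: "a = p * b" "b \<in> A" using p(4) by (auto simp: multiples_def)
  have b0: "b \<noteq> 0" using a b by (auto simp: D_def)
  have "a * f \<notin> multiples R p"
  proof
    assume "a * f \<in> multiples R p"
    then obtain r where "a * f = p * r" "r \<in> R" by (auto simp: multiples_def)
    hence "b * f \<in> R" using b p(2) by (simp add: mult.assoc)
    hence "D b" using b b0 by (simp add: D_def)
    hence "nat (- v a) \<le> nat (- v b)" by (rule min)
    moreover have "v a = v p + v b" using b p(2) b0 by (simp add: v_mult)
    ultimately show False using p(3) v_A[OF b(2) b0] by auto
  qed
  then obtain Q where Q: "is_place K Q" "\<And>r. r \<in> R \<Longrightarrow> Q r \<ge> 0" "Q (a * f) = 0" "Q p = 1"
    using U.place_exists[OF K, of "a * f"] subset_poly_ring[OF K] A_R a unfolding D_def by blast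
  interpret Q: place K Q by unfold_locales (rule Q(1))
  have f0: "f \<noteq> 0" using f R_closed(1) by auto
  \<comment> \<open>The left side is 0, while \<open>Q p = 1\<close> and \<open>Q b\<close> is
    nonnegative, so \<open>Q f\<close> must be negative.\<close>
  have "Q (a * f) = Q p + Q b + Q f" using b p(2) b0 f0 by (simp add: Q.v_mult)
  moreover have "Q b \<ge> 0" "Q z \<ge> 0" using Q(2) b A_R gen_in_poly_ring[OF K] by blast+
  ultimately show ?thesis using Q by auto
qed

end

section \<open>Uniqueness of the place at infinity and its Weierstrass semigroup\<close>

lemma v_adjoin_unique:
  assumes "place K v" "place K v'"
    and "\<forall>u\<in>B. 2 * d dvd v u" "\<not> 2 * d dvd v x" "d dvd v x" "x \<noteq> 0"
    and "\<forall>u\<in>B. v' u = v u" "v' x = v x"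
  shows "\<forall>a\<in>adjoin B x. v' a = v a"
proof
  interpret v: place K v by fact
  interpret v': place K v' by fact
  fix a assume "a \<in> adjoin B x"
  then obtain b c where bc: "a = b + c * x" "b \<in> B" "c \<in> B" by (auto simp: adjoin_def)
  show "v' a = v a"
  proof (cases "b = 0 \<or> c = 0")
    case True
    thus ?thesis using bc assms(6-8) by (cases "c = 0") (auto simp: v.v_mult v'.v_mult)
  next
    case False
    have d': "\<forall>u\<in>B. 2 * d dvd v' u" "\<not> 2 * d dvd v' x" "d dvd v' x" using assms by auto
    show ?thesis unfolding bc(1)
      using v.adjoin_valuation(3)[OF assms(3-6) bc(2,3)] v'.adjoin_valuation(3)[OF d' assms(6) bc(2,3)]
        False assms(7,8) bc by auto
  qed
qed

text \<open>The values of \<open>z\<close>, \<open>w\<close>, \<open>y\<close>, \<open>x\<close> are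
  known numbers. They determine the valuation on \<open>K[z]\<close> by the degree, then on each
  step of the tower by the minimum formula, and finally on quotients.\<close>

lemma curve_place_unique:
  assumes "curve K v x y z m" "curve K v' x y z m"
  shows "v' = v"
proof
  interpret v: curve K v x y z m by fact
  interpret v': curve K v' x y z m by fact
  note [simp] = v.v_xyz v'.v_xyz
  have ww: "v'.w = v.w" by (simp add: v.w_def v'.w_def)
  have A: "v' a = v a" if a: "a \<in> poly_ring K z" for a
  proof -
    obtain q where q: "a = poly q z" "\<forall>i. coeff q i \<in> K" using a by (auto simp: poly_ring_def)
    thus ?thesis using v.v_poly[of q] v'.v_poly[of q] by (cases "q = 0") auto
  qed
  have pl: "place K v" "place K v'" by unfold_locales
  have "v' v.w = v v.w" using v'.v_xyz(4) v.v_xyz(4) ww by simp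
  hence "\<forall>a\<in>v.R1. v' a = v a" unfolding v.R1_def
    using A by (intro v_adjoin_unique[OF pl v.dvd_v_A v.odd_dvd(1,2) v.w_nz]) auto
  hence "\<forall>a\<in>v.R2. v' a = v a" unfolding v.R2_def
    by (intro v_adjoin_unique[OF pl v.dvd_v_R1 v.odd_dvd(3,4) v.y_nz]) auto
  hence R: "\<forall>a\<in>v.R. v' a = v a" unfolding v.R_def
    by (intro v_adjoin_unique[OF pl v.dvd_v_R2 v.odd_dvd(5,6) v.x_nz]) auto
  fix f
  show "v' f = v f"
  proof (cases "f = 0")
    case False
    obtain a where a: "a \<in> poly_ring K z" "a \<noteq> 0" "a * f \<in> v.R" using v.fraction_R by blast
    have "v' a + v' f = v a + v f"
      using R a(3) v.v_mult[OF a(2) False] v'.v_mult[OF a(2) False] by simp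
    thus ?thesis using A a by simp
  qed simp
qed

text \<open>Translation by 1 permutes \<open>K\<close>, so the sum over \<open>K\<close> does not
  change when 1 is added to each term. This supplies characteristic 2 for the constant
  field.\<close>

lemma card_subring_eq_0:
  assumes "is_subring (K :: 'f::field set)" "finite K"
  shows "of_nat (card K) = (0 :: 'f)"
proof -
  note s = is_subringD[OF assms(1)]
  have "bij_betw (\<lambda>a. a + 1) K K"
    by (rule bij_betw_byWitness[where f' = "\<lambda>a. a - 1"]) (use s in auto)
  hence "(\<Sum>a\<in>K. a + 1) = \<Sum>K" using sum.reindex_bij_betw[of "\<lambda>a. a + 1" K K "\<lambda>a. a"] by simp
  thus ?thesis by (simp add: sum.distrib)
qed

definition GGS_semigroup :: "nat \<Rightarrow> nat set" where
  "GGS_semigroup m = {3 * i * m + 2 * j * m + 8 * k | i j k. i \<le> 1 \<and> j \<le> 3}"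

text \<open>A function without poles outside \<open>P\<close> lies in \<open>R\<close>, where pole
  orders are known; conversely, monomials in \<open>x\<close>, \<open>y\<close>, \<open>z\<close>
  realize every listed order.\<close>

lemma weierstrass_semigroup_GGS:
  assumes n: "odd n" and m: "m = (2 ^ n + 1) div 3" "odd m"
    and F: "GGS_function_field n K x y z" and P: "is_place_at_infinity K x y z P"
  shows "weierstrass_semigroup K P = GGS_semigroup m"
proof -
  have K: "is_subfield K" and card: "card K = 2 ^ (2 * n)" and trans: "transcendental_over K z"
    and eqs: "x ^ 2 + x = y ^ 3" "y ^ 4 - y = z ^ m"
    and gen: "\<And>L. is_subfield L \<Longrightarrow> K \<subseteq> L \<Longrightarrow> {x, y, z} \<subseteq> L \<Longrightarrow> L = UNIV"
    using F m by (auto simp: GGS_function_field_def)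
  have "of_nat (card K) = (0::'a)"
    using card card_subring_eq_0[OF is_subring_subfield[OF K]] by (metis card.infinite of_nat_0)
  hence two: "(2::'a) = 0" by (simp add: card)
  have z0: "z \<noteq> 0"
  proof
    assume "z = 0"
    hence "poly [:0, 1:] z = 0" by simp
    moreover have "\<forall>i. coeff [:0, 1:] i \<in> K"
      using K by (auto simp: is_subfield_def coeff_pCons split: nat.splits)
    ultimately have "[:0, 1::'a:] = 0" using trans unfolding transcendental_over_def by blast
    thus False by simp
  qed
  have curve: "curve K Q x y z m" if "is_place_at_infinity K x y z Q" for Q
    using that K two eqs m z0 gen
    by unfold_locales (auto simp: is_place_at_infinity_def)
  interpret P: curve K P x y z m using P by (rule curve)
  have regular: "Q x \<ge> 0 \<and> Q y \<ge> 0 \<and> Q z \<ge> 0" if "is_place K Q" "Q \<noteq> P" for Q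
    using that curve_place_unique[OF curve[OF P] curve[of Q]]
    by (force simp: is_place_at_infinity_def)
  show ?thesis
  proof (intro equalityI subsetI)
    fix r assume "r \<in> weierstrass_semigroup K P"
    then obtain f where f: "f \<noteq> 0"
      and div: "\<And>Q. is_place K Q \<Longrightarrow> max 0 (- Q f) = (if Q = P then int r else 0)"
      by (auto simp: weierstrass_semigroup_def)
    have "f \<in> P.R"
    proof (rule ccontr)
      assume "f \<notin> P.R"
      then obtain Q where Q: "is_place K Q" "Q z \<ge> 0" "Q f < 0" using P.pole_exists by blast
      \<comment> \<open>The only pole of \<open>f\<close> can be at \<open>P\<close>, but
        \<open>z\<close> has a pole at \<open>P\<close> and none at \<open>Q\<close>.\<close>
      hence "Q = P" using div[of Q] by (auto split: if_splits)
      thus False using Q P.v_xyz by simp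
    qed
    then obtain i j k where ijk: "i \<le> 1" "j \<le> 3" "- P f = int (3 * i * m + 2 * j * m + 8 * k)"
      using P.pole_order_R f by blast
    hence "int r = int (3 * i * m + 2 * j * m + 8 * k)" using div[OF P.place] by simp
    hence "r = 3 * i * m + 2 * j * m + 8 * k" by (simp only: of_nat_eq_iff)
    thus "r \<in> GGS_semigroup m" using ijk unfolding GGS_semigroup_def by blast
  next
    fix r assume "r \<in> GGS_semigroup m"
    then obtain i j k where ijk: "r = 3 * i * m + 2 * j * m + 8 * k"
      by (auto simp: GGS_semigroup_def)
    \<comment> \<open>The powers of \<open>y\<close> up to 3 replace the products of
      \<open>y\<close> and \<open>w\<close>, with the same pole orders.\<close>
    define f where "f = x ^ i * y ^ j * z ^ k"
    have f0: "f \<noteq> 0" using P.x_nz P.y_nz z0 by (simp add: f_def)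
    have v: "Q f = int i * Q x + int j * Q y + int k * Q z" if "is_place K Q" for Q
    proof -
      interpret Q: place K Q by unfold_locales (rule that)
      show ?thesis using P.x_nz P.y_nz z0 by (simp add: f_def Q.v_mult Q.v_power)
    qed
    have "max 0 (- Q f) = (if Q = P then int r else 0)" if Q: "is_place K Q" for Q
    proof (cases "Q = P")
      case True
      have "P f = - int r" using v[OF P.place] P.v_xyz by (simp add: ijk)
      thus ?thesis using True by simp
    next
      case False
      have "Q f \<ge> 0" unfolding v[OF Q] using regular[OF Q False]
        by (intro add_nonneg_nonneg mult_nonneg_nonneg) auto
      thus ?thesis using False by simp
    qed
    thus "r \<in> weierstrass_semigroup K P" using f0 unfolding weierstrass_semigroup_def by blast
  qed
qed

section \<open>The order bound\<close>

definition decompositions :: "nat set \<Rightarrow> nat \<Rightarrow> (nat \<times> nat) set" where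
  "decompositions H h = {(a, b). a \<in> H \<and> b \<in> H \<and> a + b = h}"

lemma finite_decompositions: "finite (decompositions H h)"
  by (rule finite_subset[of _ "{..h} \<times> {..h}"]) (auto simp: decompositions_def)

text \<open>The enumeration is increasing, so the indices \<open>r >= l\<close> correspond to the
  elements of \<open>H\<close> from \<open>e\<close> on. Because \<open>rho\<close> starts at index
  1, \<open>rho H (l + 1)\<close> is \<open>enumerate H l\<close>.\<close>

lemma d_ORD_eqI:
  assumes H: "infinite H" and e: "rho H (l + 1) = e"
    and h: "h \<in> H" "e \<le> h" "card (decompositions H h) = d"
    and min: "\<And>h'. h' \<in> H \<Longrightarrow> e \<le> h' \<Longrightarrow> d \<le> card (decompositions H h')"
  shows "d_ORD H l = d"
proof -
  have nu: "nu H r = card (decompositions H (enumerate H r))" for r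
    by (simp add: nu_def rho_def decompositions_def)
  have e': "enumerate H l = e" using e by (simp add: rho_def)
  obtain r where r: "enumerate H r = h" using enumerate_Ex[OF H h(1)] by auto
  have "enumerate H l \<le> enumerate H r" using r e' h(2) by simp
  hence "l \<le> r" using H by simp
  moreover have "nu H r = d" using nu r h(3) by simp
  ultimately have "d \<in> {nu H r | r. r \<ge> l}" by blast
  moreover have "d \<le> c" if c: "c \<in> {nu H r | r. r \<ge> l}" for c
  proof -
    obtain r where r: "c = nu H r" "l \<le> r" using c by blast
    have "e \<le> enumerate H r" unfolding e'[symmetric] using r(2) H by simp
    thus ?thesis unfolding r(1) nu by (intro min enumerate_in_set H)
  qed
  ultimately show ?thesis unfolding d_ORD_def by (intro cInf_eq_minimum)
qed

text \<open>The arithmetic for an element \<open>a * M + 8 * l\<close> with \<open>N\<close>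
  decompositions that exceeds \<open>c * M\<close>; \<open>M\<close> stands for \<open>m\<close>.
  The inequality survives the replacement of \<open>M\<close> by 11, after which every case is
  linear.\<close>

lemma count_bound:
  fixes N l a c d M :: nat
  assumes c: "c = 0 \<or> c * M < a * M + 8 * l" and pos: "0 < a * M + 8 * l" and M: "M \<ge> 11"
    and d: "d = 2 \<and> c = 0 \<or> d = 3 \<and> c = 3 \<or> d = 4 \<and> c = 4 \<or> d = 5 \<and> c = 5 \<or>
      d = 6 \<and> c = 6 \<or> d = 8 \<and> c = 7"
    and N: "a = 0 \<and> l + 1 \<le> N \<or> a = 2 \<and> 2 * l + 2 \<le> N \<or> a = 3 \<and> 2 * l + 2 \<le> N \<or>
      a = 4 \<and> 3 * l + 3 \<le> N \<or> a = 5 \<and> 4 * l + 4 \<le> N \<or>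
      a = 6 \<and> 4 * l + 4 \<le> N \<and> 5 \<le> N \<or> a = 7 \<and> 6 * l + 6 \<le> N \<or> a = 9 \<and> 8 * l + 8 \<le> N"
  shows "d \<le> N"
proof -
  have "c = 0 \<or> 11 * c < 11 * a + 8 * l"
  proof (cases "c \<le> a")
    case True
    thus ?thesis using c by (cases "c = a") auto
  next
    case False
    then obtain e where e: "c = a + e" using less_imp_add_positive not_le by blast
    hence "e * M < 8 * l" using c False by (auto simp: add_mult_distrib)
    moreover have "e * 11 \<le> e * M" using M by (rule mult_le_mono2)
    ultimately show ?thesis using e by linarith
  qed
  moreover have "a = 0 \<longrightarrow> l > 0" using pos by auto
  ultimately show ?thesis using d N by (elim disjE conjE; hypsubst; simp; linarith?)
qed

text \<open>The argument \<open>q\<close> comes from \<open>3 m = 2\<^sup>n + 1\<close>, that is, \<open>m \<equiv> 3\<close> modulo 8.\<close>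

locale semigroup_mod_8 =
  fixes m q :: nat
  assumes m: "m = 8 * q + 3" and q: "q \<ge> 1"
begin

abbreviation H where "H \<equiv> GGS_semigroup m"

lemma H_I: "i \<le> 1 \<Longrightarrow> j \<le> 3 \<Longrightarrow> 3 * i * m + 2 * j * m + 8 * k \<in> H"
  unfolding GGS_semigroup_def by blast

text \<open>The values of \<open>3 * i + 2 * j\<close> for \<open>i <= 1\<close> and
  \<open>j <= 3\<close>; they represent each residue class modulo 8 exactly once.\<close>

definition V :: "nat set" where
  "V = {0, 2, 3, 4, 5, 6, 7, 9}"

lemma H_iff: "h \<in> H \<longleftrightarrow> (\<exists>c\<in>V. \<exists>k. h = c * m + 8 * k)"
proof
  assume "h \<in> H"
  then obtain i j k where h: "h = 3 * i * m + 2 * j * m + 8 * k" "i \<le> 1" "j \<le> 3"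
    by (auto simp: GGS_semigroup_def)
  have "i \<in> {0, 1}" "j \<in> {0, 1, 2, 3}" using h by auto
  hence "3 * i + 2 * j \<in> V" unfolding V_def by (elim insertE emptyE) simp_all
  moreover have "h = (3 * i + 2 * j) * m + 8 * k" using h by (simp add: algebra_simps)
  ultimately show "\<exists>c\<in>V. \<exists>k. h = c * m + 8 * k" by blast
next
  assume "\<exists>c\<in>V. \<exists>k. h = c * m + 8 * k"
  then obtain c k where h: "c \<in> V" "h = c * m + 8 * k" by blast
  show "h \<in> H"
    using h H_I[of 0 0 k] H_I[of 0 1 k] H_I[of 0 2 k] H_I[of 0 3 k]
      H_I[of 1 0 k] H_I[of 1 1 k] H_I[of 1 2 k] H_I[of 1 3 k]
    unfolding V_def by (elim insertE emptyE) simp_all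
qed

lemma infinite_H: "infinite H"
proof -
  have "range (\<lambda>k. 8 * k) \<subseteq> H" using H_I[of 0 0] by auto
  moreover have "infinite (range (\<lambda>k::nat. 8 * k))" by (rule range_inj_infinite) (auto simp: inj_def)
  ultimately show ?thesis by (rule infinite_super)
qed

lemma multiple_m_cong:
  assumes "c * m + 8 * k = c' * m + 8 * k'"
  shows "[c = c'] (mod 8)"
proof -
  have "[c * m = c' * m] (mod 8)"
    using assms by (metis cong_def mod_mult_self2)
  moreover have "odd m" using m by simp
  hence "coprime m (2 ^ 3)" by (simp only: coprime_power_right_iff coprime_right_2_iff_odd simp_thms)
  ultimately show ?thesis by (simp add: cong_mult_rcancel_nat)
qed

lemma representation_unique:
  assumes "3 * i * m + 2 * j * m + 8 * k = 3 * i' * m + 2 * j' * m + 8 * k'"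
    "i \<le> 1" "i' \<le> 1" "j \<le> 3" "j' \<le> 3"
  shows "i = i' \<and> j = j' \<and> k = k'"
proof -
  have "(3 * i + 2 * j) * m + 8 * k = (3 * i' + 2 * j') * m + 8 * k'"
    using assms(1) by (simp add: algebra_simps)
  hence "(3 * i + 2 * j) mod 8 = (3 * i' + 2 * j') mod 8"
    unfolding cong_def[symmetric] by (rule multiple_m_cong)
  moreover have "i \<in> {0, 1}" "i' \<in> {0, 1}" "j \<in> {0, 1, 2, 3}" "j' \<in> {0, 1, 2, 3}" using assms(2-5) by auto
  ultimately have "i = i' \<and> j = j'" by (elim insertE emptyE) simp_all
  thus ?thesis using assms(1) by simp
qed

text \<open>Splitting \<open>i\<close>, \<open>j\<close> and \<open>k\<close> independently gives
  decompositions, which are distinct because representations are unique.\<close>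

lemma card_decompositions_ge:
  assumes "h = 3 * i * m + 2 * j * m + 8 * k" "i \<le> 1" "j \<le> 3"
  shows "(i + 1) * (j + 1) * (k + 1) \<le> card (decompositions H h)"
proof -
  define T where "T = {..i} \<times> {..j} \<times> {..k}"
  define f where "f = (\<lambda>(a, b, c). (3 * a * m + 2 * b * m + 8 * c,
    3 * (i - a) * m + 2 * (j - b) * m + 8 * (k - c)))"
  have "inj_on f T"
  proof (rule inj_onI)
    fix s s' assume "s \<in> T" "s' \<in> T" "f s = f s'"
    moreover obtain a b c a' b' c' where "s = (a, b, c)" "s' = (a', b', c')"
      by (meson prod_cases3)
    ultimately show "s = s'"
      using representation_unique[of a b c a' b' c'] assms by (simp add: f_def T_def)
  qed
  moreover have "f ` T \<subseteq> decompositions H h"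
  proof
    fix s assume "s \<in> f ` T"
    then obtain a b c where abc: "a \<le> i" "b \<le> j" "c \<le> k" "s = f (a, b, c)"
      by (auto simp: T_def)
    have "a * m + (i - a) * m = i * m" "b * m + (j - b) * m = j * m"
      using abc by (simp_all flip: add_mult_distrib)
    moreover have "3 * a * m + 2 * b * m + 8 * c + (3 * (i - a) * m + 2 * (j - b) * m + 8 * (k - c)) =
      3 * (a * m + (i - a) * m) + 2 * (b * m + (j - b) * m) + 8 * (c + (k - c))"
      by (simp only: distrib_left mult.assoc add_ac)
    ultimately have "3 * a * m + 2 * b * m + 8 * c + (3 * (i - a) * m + 2 * (j - b) * m + 8 * (k - c)) = h"
      using abc assms(1) by simp
    moreover have "3 * a * m + 2 * b * m + 8 * c \<in> H"
      "3 * (i - a) * m + 2 * (j - b) * m + 8 * (k - c) \<in> H"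
      using abc assms by (auto intro!: H_I)
    ultimately show "s \<in> decompositions H h" by (simp add: decompositions_def abc(4) f_def)
  qed
  ultimately have "card T \<le> card (decompositions H h)"
    using card_inj_on_le finite_decompositions by blast
  moreover have "card T = (i + 1) * (j + 1) * (k + 1)"
    unfolding T_def by (simp only: card_cartesian_product card_atMost Suc_eq_plus1 mult.assoc)
  ultimately show ?thesis by simp
qed

lemma card_decompositions_ge':
  shows "k + 1 \<le> card (decompositions H (8 * k))"
    "2 * (k + 1) \<le> card (decompositions H (2 * m + 8 * k))"
    "3 * (k + 1) \<le> card (decompositions H (4 * m + 8 * k))"
    "4 * (k + 1) \<le> card (decompositions H (6 * m + 8 * k))"
    "2 * (k + 1) \<le> card (decompositions H (3 * m + 8 * k))"
    "4 * (k + 1) \<le> card (decompositions H (5 * m + 8 * k))"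
    "6 * (k + 1) \<le> card (decompositions H (7 * m + 8 * k))"
    "8 * (k + 1) \<le> card (decompositions H (9 * m + 8 * k))"
proof -
  note ge = card_decompositions_ge[OF refl]
  show "k + 1 \<le> card (decompositions H (8 * k))" using ge[of 0 0 k] by simp
  show "2 * (k + 1) \<le> card (decompositions H (2 * m + 8 * k))" using ge[of 0 1 k] by simp
  show "3 * (k + 1) \<le> card (decompositions H (4 * m + 8 * k))" using ge[of 0 2 k] by simp
  show "4 * (k + 1) \<le> card (decompositions H (6 * m + 8 * k))" using ge[of 0 3 k] by simp
  show "2 * (k + 1) \<le> card (decompositions H (3 * m + 8 * k))" using ge[of 1 0 k] by simp
  show "4 * (k + 1) \<le> card (decompositions H (5 * m + 8 * k))" using ge[of 1 1 k] by simp
  show "6 * (k + 1) \<le> card (decompositions H (7 * m + 8 * k))" using ge[of 1 2 k] by simp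
  show "8 * (k + 1) \<le> card (decompositions H (9 * m + 8 * k))" using ge[of 1 3 k] by simp
qed

text \<open>In a decomposition of \<open>c * m\<close> the coefficients of \<open>m\<close> add up
  to at most \<open>c\<close> and to \<open>c\<close> modulo 8. A drop by 8 would require
  \<open>c = 9\<close> and sum 1, which two elements of \<open>V\<close> cannot have. So no
  multiples of 8 are left over.\<close>

lemma card_decompositions_multiple:
  assumes c: "c \<le> 9" "c \<noteq> 8"
  shows "card (decompositions H (c * m)) = card (V \<inter> {a. a \<le> c \<and> c - a \<in> V})"
proof -
  define f where "f a = (a * m, (c - a) * m)" for a
  have f: "(a, b) \<in> f ` (V \<inter> {a. a \<le> c \<and> c - a \<in> V})" if ab: "a \<in> H" "b \<in> H" "a + b = c * m" for a b
  proof -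
    obtain a' k b' k' where h: "a' \<in> V" "a = a' * m + 8 * k" "b' \<in> V" "b = b' * m + 8 * k'"
      using ab(1,2) by (auto simp: H_iff)
    have eq: "(a' + b') * m + 8 * (k + k') = c * m + 8 * 0"
      using ab(3) h by (simp add: algebra_simps)
    hence "[a' + b' = c] (mod 8)" by (rule multiple_m_cong)
    moreover have "(a' + b') * m \<le> c * m" using eq by linarith
    hence "a' + b' \<le> c" using m by simp
    moreover have "a' + b' \<noteq> 1" using h by (auto simp: V_def)
    ultimately have "8 dvd c - (a' + b')" by (metis cong_def mod_eq_dvd_iff_nat)
    then obtain u where "c - (a' + b') = 8 * u" by blast
    hence c': "c = a' + b'" using c \<open>a' + b' \<le> c\<close> \<open>a' + b' \<noteq> 1\<close>
      by (cases "u = 0"; cases "u = 1") linarith+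
    hence "k = 0" "k' = 0" using eq by auto
    thus ?thesis using h c' by (intro image_eqI[of _ _ a']) (auto simp: f_def)
  qed
  have f': "f a \<in> decompositions H (c * m)" if a: "a \<in> V" "a \<le> c" "c - a \<in> V" for a
  proof -
    have "a * m = a * m + 8 * 0" "(c - a) * m = (c - a) * m + 8 * 0" by simp_all
    hence "a * m \<in> H" "(c - a) * m \<in> H" using a unfolding H_iff by blast+
    moreover have "a * m + (c - a) * m = c * m" using a by (simp flip: add_mult_distrib)
    ultimately show ?thesis by (simp add: decompositions_def f_def)
  qed
  have "decompositions H (c * m) = f ` (V \<inter> {a. a \<le> c \<and> c - a \<in> V})"
  proof
    show "decompositions H (c * m) \<subseteq> f ` (V \<inter> {a. a \<le> c \<and> c - a \<in> V})"
      by (rule subrelI) (rule f, simp_all add: decompositions_def)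
    show "f ` (V \<inter> {a. a \<le> c \<and> c - a \<in> V}) \<subseteq> decompositions H (c * m)" using f' by blast
  qed
  moreover have "inj f" using m by (auto simp: inj_def f_def)
  ultimately show ?thesis by (simp add: card_image inj_on_subset[of f UNIV])
qed

text \<open>These equal the product bound except at \<open>6 * m\<close>, where
  \<open>3 * m + 3 * m\<close> is a fifth decomposition.\<close>

lemma card_decompositions_eq:
  "card (decompositions H (3 * m)) = 2" "card (decompositions H (4 * m)) = 3"
  "card (decompositions H (5 * m)) = 4" "card (decompositions H (6 * m)) = 5"
  "card (decompositions H (7 * m)) = 6" "card (decompositions H (9 * m)) = 8"
proof -
  have "V \<inter> {a. a \<le> 3 \<and> 3 - a \<in> V} = {0, 3}" "V \<inter> {a. a \<le> 4 \<and> 4 - a \<in> V} = {0, 2, 4}"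
    "V \<inter> {a. a \<le> 5 \<and> 5 - a \<in> V} = {0, 2, 3, 5}" "V \<inter> {a. a \<le> 6 \<and> 6 - a \<in> V} = {0, 2, 3, 4, 6}"
    "V \<inter> {a. a \<le> 7 \<and> 7 - a \<in> V} = {0, 2, 3, 4, 5, 7}"
    "V \<inter> {a. a \<le> 9 \<and> 9 - a \<in> V} = {0, 2, 3, 4, 5, 6, 7, 9}"
    by (simp_all add: V_def Int_insert_left)
  thus "card (decompositions H (3 * m)) = 2" "card (decompositions H (4 * m)) = 3"
    "card (decompositions H (5 * m)) = 4" "card (decompositions H (6 * m)) = 5"
    "card (decompositions H (7 * m)) = 6" "card (decompositions H (9 * m)) = 8"
    by (simp_all add: card_decompositions_multiple)
qed

lemma card_decompositions_min:
  assumes h: "h \<in> H" and d: "(d, c) \<in> {(2, 0), (3, 3), (4, 4), (5, 5), (6, 6), (8, 7)}"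
    and e: "k > 0" "8 * k \<ge> c * m" "8 * k \<le> h"
  shows "d \<le> card (decompositions H h)"
proof -
  obtain a l where al: "a \<in> V" "h = a * m + 8 * l" using h by (auto simp: H_iff)
  define N where "N = card (decompositions H h)"
  have N: "a = 0 \<and> l + 1 \<le> N \<or> a = 2 \<and> 2 * l + 2 \<le> N \<or> a = 3 \<and> 2 * l + 2 \<le> N \<or>
    a = 4 \<and> 3 * l + 3 \<le> N \<or> a = 5 \<and> 4 * l + 4 \<le> N \<or> a = 6 \<and> 4 * l + 4 \<le> N \<and> 5 \<le> N \<or>
    a = 7 \<and> 6 * l + 6 \<le> N \<or> a = 9 \<and> 8 * l + 8 \<le> N"
  proof -
    \<comment> \<open>For \<open>l = 0\<close> the product bound is only 4, so the exact count at
      \<open>6 * m\<close> is used.\<close>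
    have "5 \<le> card (decompositions H (6 * m + 8 * l))"
      using card_decompositions_eq(4) card_decompositions_ge'(4)[of l] by (cases "l = 0") auto
    thus ?thesis using al(1) card_decompositions_ge'[of l] unfolding V_def N_def al(2)
      by (elim insertE emptyE) simp_all
  qed
  \<comment> \<open>Strictness matters: \<open>c * m\<close> itself has fewer than \<open>d\<close>
    decompositions when \<open>c\<close> is nonzero. Equality is impossible, as \<open>m\<close> is
    odd and \<open>0 < c < 8\<close>.\<close>
  have "c = 0 \<or> c * m < 8 * k"
  proof (rule ccontr)
    assume "\<not> (c = 0 \<or> c * m < 8 * k)"
    hence "c * m = 8 * k" "c \<noteq> 0" using e by auto
    moreover from this have "[c = 0] (mod 8)" using multiple_m_cong[of c 0 0 k] by simp
    ultimately show False using d by (auto simp: cong_def)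
  qed
  hence c: "c = 0 \<or> c * m < h" "0 < h" using e by auto
  have "m \<ge> 11" using m q by simp
  moreover have "d = 2 \<and> c = 0 \<or> d = 3 \<and> c = 3 \<or> d = 4 \<and> c = 4 \<or> d = 5 \<and> c = 5 \<or> d = 6 \<and> c = 6 \<or> d = 8 \<and> c = 7"
    using d by auto
  ultimately have "d \<le> N" using N by (rule count_bound[OF c[unfolded al(2)]])
  thus ?thesis by (simp add: N_def)
qed

text \<open>In a triple, \<open>d\<close> is the bound for \<open>8 * k\<close> between
  \<open>c * m\<close> and \<open>c' * m\<close>, and the minimum is attained at
  \<open>c' * m\<close>.\<close>

lemma d_ORD_GGS:
  assumes l: "rho H (l + 1) = 8 * k" "l \<ge> 1"
    and d: "(d, c, c') \<in> {(2, 0, 3), (3, 3, 4), (4, 4, 5), (5, 5, 6), (6, 6, 7), (8, 7, 9)}"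
    and k: "c * m \<le> 8 * k" "8 * k \<le> c' * m"
  shows "d_ORD H l = d"
proof (rule d_ORD_eqI[OF infinite_H l(1)])
  \<comment> \<open>The element 0, which has a single decomposition, is excluded by
    \<open>l >= 1\<close>.\<close>
  have "enumerate H 0 < enumerate H l" using l(2) infinite_H by (simp add: enumerate_mono)
  hence k0: "k > 0" using l(1) by (simp add: rho_def)
  have "c' \<in> V" using d by (auto simp: V_def)
  hence "c' * m + 8 * 0 \<in> H" unfolding H_iff by blast
  thus "c' * m \<in> H" by simp
  show "8 * k \<le> c' * m" by fact
  show "card (decompositions H (c' * m)) = d"
    using d by (elim insertE emptyE) (simp_all add: card_decompositions_eq)
  show "d \<le> card (decompositions H h)" if "h \<in> H" "8 * k \<le> h" for h
    using that d k0 k by (intro card_decompositions_min[of h d c k]) auto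
qed

end

theorem lemma3p8:
  fixes n m l k :: nat
    and K :: "'f::field set" and x y z :: 'f and P :: "'f \<Rightarrow> int"
    and H :: "nat set"
  assumes "n \<ge> 5" and "odd n" and "m = (2 ^ n + 1) div 3"
    and "GGS_function_field n K x y z"
    and "is_place_at_infinity K x y z P"
    and "H = weierstrass_semigroup K P"
    and "l \<ge> 1" and "rho H (l + 1) = 8 * k" and "k < m"
  shows
    "(int k \<le> \<lfloor>3 * real m / 8\<rfloor> \<longrightarrow> d_ORD H l = 2) \<and>
     (\<lceil>3 * real m / 8\<rceil> \<le> int k \<and> int k \<le> \<lfloor>real m / 2\<rfloor> \<longrightarrow> d_ORD H l = 3) \<and>
     (\<lceil>real m / 2\<rceil> \<le> int k \<and> int k \<le> \<lfloor>5 * real m / 8\<rfloor> \<longrightarrow> d_ORD H l = 4) \<and>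
     (\<lceil>5 * real m / 8\<rceil> \<le> int k \<and> int k \<le> \<lfloor>3 * real m / 4\<rfloor> \<longrightarrow> d_ORD H l = 5) \<and>
     (\<lceil>3 * real m / 4\<rceil> \<le> int k \<and> int k \<le> \<lfloor>7 * real m / 8\<rfloor> \<longrightarrow> d_ORD H l = 6) \<and>
     (\<lceil>7 * real m / 8\<rceil> \<le> int k \<and> int k \<le> int m - 1 \<longrightarrow> d_ORD H l = 8)"
proof -
  obtain q where q: "m = 8 * q + 3" "q \<ge> 1"
  proof -
    \<comment> \<open>With \<open>n = 2 * e + 5\<close> and \<open>4 ^ e = 3 * s + 1\<close> one
      gets \<open>2 ^ n + 1 = 3 * (32 * s + 11)\<close>, hence \<open>q = 4 * s + 1\<close>.\<close>
    obtain e where e: "n = 2 * e + 5"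
    proof -
      obtain j where "n = 2 * j + 1" using assms(2) by (rule oddE)
      thus thesis using that[of "j - 2"] assms(1) by simp
    qed
    have "[4 ^ e = 1 ^ e] (mod (3::nat))" by (rule cong_pow) (simp add: cong_def)
    hence "(4::nat) ^ e mod 3 = 1" by (simp add: cong_def)
    then obtain s where s: "(4::nat) ^ e = 3 * s + 1" by (metis mod_div_decomp mult.commute)
    have "(2::nat) ^ n = 32 * 4 ^ e" by (simp add: e power_add power_mult)
    hence "2 ^ n + 1 = 3 * (8 * (4 * s + 1) + 3)" using s by simp
    hence "m = 8 * (4 * s + 1) + 3" using assms(3) by (metis nonzero_mult_div_cancel_left zero_neq_numeral)
    thus thesis using that[of "4 * s + 1"] by simp
  qed
  interpret S: semigroup_mod_8 m q by unfold_locales (use q in auto)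
  have H: "H = GGS_semigroup m"
    using weierstrass_semigroup_GGS[OF assms(2,3) _ assms(4,5)] assms(6) q(1) by simp
  have d: "d_ORD H l = d"
    if "(d, c, c') \<in> {(2, 0, 3), (3, 3, 4), (4, 4, 5), (5, 5, 6), (6, 6, 7), (8, 7, 9)}"
      "c * m \<le> 8 * k" "8 * k \<le> c' * m" for d c c'
    using S.d_ORD_GGS[OF _ assms(7) that] assms(8) H by simp
  have floor: "int k \<le> \<lfloor>3 * real m / 8\<rfloor> \<longleftrightarrow> 8 * k \<le> 3 * m"
    "int k \<le> \<lfloor>real m / 2\<rfloor> \<longleftrightarrow> 8 * k \<le> 4 * m"
    "int k \<le> \<lfloor>5 * real m / 8\<rfloor> \<longleftrightarrow> 8 * k \<le> 5 * m"
    "int k \<le> \<lfloor>3 * real m / 4\<rfloor> \<longleftrightarrow> 8 * k \<le> 6 * m"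
    "int k \<le> \<lfloor>7 * real m / 8\<rfloor> \<longleftrightarrow> 8 * k \<le> 7 * m"
    unfolding le_floor_iff by linarith+
  have ceiling: "\<lceil>3 * real m / 8\<rceil> \<le> int k \<longleftrightarrow> 3 * m \<le> 8 * k"
    "\<lceil>real m / 2\<rceil> \<le> int k \<longleftrightarrow> 4 * m \<le> 8 * k"
    "\<lceil>5 * real m / 8\<rceil> \<le> int k \<longleftrightarrow> 5 * m \<le> 8 * k"
    "\<lceil>3 * real m / 4\<rceil> \<le> int k \<longleftrightarrow> 6 * m \<le> 8 * k"
    "\<lceil>7 * real m / 8\<rceil> \<le> int k \<longleftrightarrow> 7 * m \<le> 8 * k"
    unfolding ceiling_le_iff by linarith+
  \<comment> \<open>In the last case \<open>k < m\<close> gives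
    \<open>8 * k <= 9 * m\<close>.\<close>
  show ?thesis
    unfolding floor ceiling using d[of 2 0 3] d[of 3 3 4] d[of 4 4 5] d[of 5 5 6] d[of 6 6 7] d[of 8 7 9]
      assms(9) by (intro conjI impI) simp_all
qed

end
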